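(* Let $\mathcal M=(M,<,+,0,\ldots)$ be a definably complete locally o-minimal expansion of an ordered group. Let $(X,\tau)$ be a regular, locally definably compact definable topological space, $C$ a definable subset of $X$ closed in $(X,\tau)$, and $x\in C$ a point which is not isolated in $C$. Then there exists a definable curve $\gamma:(0,\infty)\to C\setminus\{x\}$ such that $x\in\operatorname{Conv}_{\mathrm{left}}(\gamma)\cup\operatorname{Conv}_{\mathrm{right}}(\gamma)$.
   Context: "Definable" means definable in $\mathcal M$ with parameters. $\mathcal M$ is an expansion of an ordered group with dense order without endpoints; locally o-minimal: for every definable $Y\subseteq M$ and $a\in M$ there is an open interval $I\ni a$ with $Y\cap I$ a finite union of points and open intervals; definably complete: every definable subset of $M$ has sup and inf in $M\cup\{\pm\infty\}$. A definable topological space is a definable set with a topology having a definable family as open base. It (or a definable subset with relative topology) is definably compact if every definable filtered family (for any two members some member lies in their intersection) of nonempty closed subsets has nonempty intersection; it is locally definably compact if each point has a definably compact (definable) neighborhood. A definable curve is a definable, not necessarily continuous, map from an open interval. For $\gamma:(a,b)\to X$: $\operatorname{Conv}_{\mathrm{right}}(\gamma)$ is the set of $y\in X$ such that for every $t\in(a,b)$ and every definable neighborhood $A$ of $y$, $\gamma((t,b))\cap A\ne\emptyset$; $\operatorname{Conv}_{\mathrm{left}}(\gamma)$ likewise with $\gamma((a,t))$. *)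

theory Defs
  imports "HOL-Analysis.Analysis"
begin

text \<open>Formulas of a relational first-order language with relation symbols of type 'r.
  An interpretation I :: 'r => 'm list => bool assigns to each symbol r and each
  arity k the k-ary relation (I r restricted to lists of length k); thus any relational
  structure on the universe 'm is covered, and function symbols (e.g. +) are represented
  by their graphs, which gives the same definable sets.\<close>

datatype 'r fm =
    Atom 'r "nat list"
  | Eq nat nat
  | Neg "'r fm"
  | Conj "'r fm" "'r fm"
  | Ex nat "'r fm"

fun sat :: "('r \<Rightarrow> 'm list \<Rightarrow> bool) \<Rightarrow> 'r fm \<Rightarrow> (nat \<Rightarrow> 'm) \<Rightarrow> bool" where
  "sat I (Atom r vs) e = I r (map e vs)"
| "sat I (Eq i j) e = (e i = e j)"
| "sat I (Neg \<phi>) e = (\<not> sat I \<phi> e)"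
| "sat I (Conj \<phi> \<psi>) e = (sat I \<phi> e \<and> sat I \<psi> e)"
| "sat I (Ex i \<phi>) e = (\<exists>a. sat I \<phi> (e(i := a)))"

text \<open>A subset of M^n (tuples as lists of length n) is definable with parameters:
  variables 0..n-1 carry the tuple, all other variables carry parameters.\<close>

definition definable :: "('r \<Rightarrow> 'm list \<Rightarrow> bool) \<Rightarrow> nat \<Rightarrow> 'm list set \<Rightarrow> bool" where
  "definable I n D \<longleftrightarrow>
     (\<exists>\<phi> e. D = {xs. length xs = n \<and> sat I \<phi> (\<lambda>i. if i < n then xs ! i else e i)})"

definition expands_ordered_group :: "('r \<Rightarrow> 'm::{group_add,linorder} list \<Rightarrow> bool) \<Rightarrow> bool" where
  "expands_ordered_group I \<longleftrightarrow>
     (\<exists>rl rp rz. (\<forall>a b. I rl [a, b] \<longleftrightarrow> a < b) \<and>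
                (\<forall>a b c. I rp [a, b, c] \<longleftrightarrow> c = a + b) \<and>
                (\<forall>a. I rz [a] \<longleftrightarrow> a = 0))"

definition ordered_group_dense_no_endpoints :: "'m::{group_add,linorder} itself \<Rightarrow> bool" where
  "ordered_group_dense_no_endpoints _ \<longleftrightarrow>
     (\<forall>a b c::'m. a < b \<longrightarrow> a + c < b + c \<and> c + a < c + b) \<and>
     (\<forall>a b::'m. a < b \<longrightarrow> (\<exists>c. a < c \<and> c < b)) \<and>
     (\<forall>a::'m. (\<exists>b. b < a) \<and> (\<exists>b. a < b))"

definition locally_o_minimal :: "('r \<Rightarrow> 'm::linorder list \<Rightarrow> bool) \<Rightarrow> bool" where
  "locally_o_minimal I \<longleftrightarrow>
     (\<forall>Y a. definable I 1 Y \<longrightarrow>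
        (\<exists>l u. l < a \<and> a < u \<and>
           (\<exists>P. finite P \<and> (\<forall>S\<in>P. (\<exists>p. S = {p}) \<or> (\<exists>c d. S = {c<..<d})) \<and>
                {y. [y] \<in> Y} \<inter> {l<..<u} = \<Union>P)))"

definition definably_complete :: "('r \<Rightarrow> 'm::linorder list \<Rightarrow> bool) \<Rightarrow> bool" where
  "definably_complete I \<longleftrightarrow>
     (\<forall>Y. definable I 1 Y \<longrightarrow>
        (let Y' = {y. [y] \<in> Y} in
          (Y' \<noteq> {} \<and> (\<exists>b. \<forall>y\<in>Y'. y \<le> b) \<longrightarrow>
             (\<exists>s. (\<forall>y\<in>Y'. y \<le> s) \<and> (\<forall>b. (\<forall>y\<in>Y'. y \<le> b) \<longrightarrow> s \<le> b))) \<and>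
          (Y' \<noteq> {} \<and> (\<exists>b. \<forall>y\<in>Y'. b \<le> y) \<longrightarrow>
             (\<exists>s. (\<forall>y\<in>Y'. s \<le> y) \<and> (\<forall>b. (\<forall>y\<in>Y'. b \<le> y) \<longrightarrow> b \<le> s)))))"

definition fibre :: "nat \<Rightarrow> 'm list set \<Rightarrow> 'm list \<Rightarrow> 'm list set" where
  "fibre n F y = {xs. length xs = n \<and> xs @ y \<in> F}"

definition definable_top_space ::
  "('r \<Rightarrow> 'm list \<Rightarrow> bool) \<Rightarrow> nat \<Rightarrow> 'm list topology \<Rightarrow> bool" where
  "definable_top_space I n \<tau> \<longleftrightarrow>
     definable I n (topspace \<tau>) \<and>
     (\<exists>k B Y. definable I (n + k) B \<and> definable I k Y \<and>
        (\<forall>y\<in>Y. openin \<tau> (fibre n B y)) \<and>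
        (\<forall>U. openin \<tau> U \<longrightarrow> (\<forall>z\<in>U. \<exists>y\<in>Y. z \<in> fibre n B y \<and> fibre n B y \<subseteq> U)))"

definition is_nbhd :: "'a topology \<Rightarrow> 'a set \<Rightarrow> 'a \<Rightarrow> bool" where
  "is_nbhd \<tau> A z \<longleftrightarrow> (\<exists>U. openin \<tau> U \<and> z \<in> U \<and> U \<subseteq> A)"

definition definably_compact ::
  "('r \<Rightarrow> 'm list \<Rightarrow> bool) \<Rightarrow> nat \<Rightarrow> 'm list topology \<Rightarrow> 'm list set \<Rightarrow> bool" where
  "definably_compact I n \<tau> K \<longleftrightarrow>
     (\<forall>k F Y. definable I (n + k) F \<and> definable I k Y \<and>
        (\<forall>y\<in>Y. fibre n F y \<noteq> {} \<and> closedin (subtopology \<tau> K) (fibre n F y)) \<and>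
        (\<forall>y1\<in>Y. \<forall>y2\<in>Y. \<exists>y3\<in>Y. fibre n F y3 \<subseteq> fibre n F y1 \<inter> fibre n F y2)
        \<longrightarrow> (\<Inter>y\<in>Y. fibre n F y) \<noteq> {})"

definition locally_definably_compact ::
  "('r \<Rightarrow> 'm list \<Rightarrow> bool) \<Rightarrow> nat \<Rightarrow> 'm list topology \<Rightarrow> bool" where
  "locally_definably_compact I n \<tau> \<longleftrightarrow>
     (\<forall>z\<in>topspace \<tau>. \<exists>N. definable I n N \<and> N \<subseteq> topspace \<tau> \<and> is_nbhd \<tau> N z \<and>
        definably_compact I n \<tau> N)"

definition definable_curve ::
  "('r \<Rightarrow> 'm list \<Rightarrow> bool) \<Rightarrow> nat \<Rightarrow> 'm set \<Rightarrow> ('m \<Rightarrow> 'm list) \<Rightarrow> bool" where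
  "definable_curve I n S \<gamma> \<longleftrightarrow>
     (\<forall>t\<in>S. length (\<gamma> t) = n) \<and> definable I (Suc n) {t # \<gamma> t | t. t \<in> S}"

text \<open>For \<gamma> defined on S = (a,b): {s\<in>S. t < s} = (t,b) and {s\<in>S. s < t} = (a,t).\<close>
definition conv_right ::
  "('r \<Rightarrow> 'm::linorder list \<Rightarrow> bool) \<Rightarrow> nat \<Rightarrow> 'm list topology \<Rightarrow> 'm set \<Rightarrow> ('m \<Rightarrow> 'm list) \<Rightarrow> 'm list set" where
  "conv_right I n \<tau> S \<gamma> = {z \<in> topspace \<tau>. \<forall>t\<in>S. \<forall>A. definable I n A \<and> is_nbhd \<tau> A z \<longrightarrow>
        \<gamma> ` {s\<in>S. t < s} \<inter> A \<noteq> {}}"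

definition conv_left ::
  "('r \<Rightarrow> 'm::linorder list \<Rightarrow> bool) \<Rightarrow> nat \<Rightarrow> 'm list topology \<Rightarrow> 'm set \<Rightarrow> ('m \<Rightarrow> 'm list) \<Rightarrow> 'm list set" where
  "conv_left I n \<tau> S \<gamma> = {z \<in> topspace \<tau>. \<forall>t\<in>S. \<forall>A. definable I n A \<and> is_nbhd \<tau> A z \<longrightarrow>
        \<gamma> ` {s\<in>S. s < t} \<inter> A \<noteq> {}}"

end

theory Submission
  imports Defs
begin

text \<open>Order the indices of a definable neighbourhood base at \<open>x\<close> by reverse inclusion. Such a definable
  directed set can be exhausted by sets \<open>K\<^sub>s\<^sub>,\<^sub>u\<close>, increasing as \<open>s\<close> tends to 0 and \<open>u\<close> to infinity, each of
  which has an upper bound. The exhaustion is built one coordinate at a time: outside a discrete set of bad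
  values of the coordinate, an upper bound for one fibre is an upper bound for all nearby fibres, and
  definable compactness of closed bounded boxes yields a common one.

  Definable choice then gives \<open>f(s,u)\<close> in \<open>C - {x}\<close> inside the neighbourhood bounding \<open>K\<^sub>s\<^sub>,\<^sub>u\<close> and inside
  a definably compact neighbourhood of \<open>x\<close>. For each \<open>s\<close>, the curve \<open>u \<mapsto> f(s,u)\<close> has a limit
  point as \<open>u\<close> tends to infinity. If \<open>x\<close> is one for some \<open>s\<close>, that curve is as wanted; otherwise choose
  a limit point \<open>g(s)\<close> definably, and by regularity \<open>g(s)\<close> tends to \<open>x\<close> as \<open>s\<close> tends to 0.\<close>


text \<open>What replaces them is weak: one-sided germs of definable sets are full or empty, bounded
  definable sets have suprema, and choice is definable. From this, every definable function on an
  interval is continuous somewhere. Two parameters occur because there are two unrelated limits: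
  \<open>u\<close> bounds coordinates and auxiliary data from above, \<open>s\<close> bounds margins
  and radii from below. They cannot be merged in general: over the ordered additive group of the
  reals, say, no definable function on \<open>(0,a)\<close> tends to infinity at 0. A curve that
  follows \<open>u\<close> alone sees only part of the neighbourhood base; the limit point
  \<open>g(s)\<close> is what allows \<open>s\<close> to move as well. This is also why the end of
  the interval at which the curve approaches \<open>x\<close> is left open.\<close>

fun rename_fm :: "(nat \<Rightarrow> nat) \<Rightarrow> 'r fm \<Rightarrow> 'r fm" where
  "rename_fm f (Atom r vs) = Atom r (map f vs)"
| "rename_fm f (Eq i j) = Eq (f i) (f j)"
| "rename_fm f (Neg \<phi>) = Neg (rename_fm f \<phi>)"
| "rename_fm f (Conj \<phi> \<psi>) = Conj (rename_fm f \<phi>) (rename_fm f \<psi>)"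
| "rename_fm f (Ex i \<phi>) = Ex (f i) (rename_fm f \<phi>)"

text \<open>Bound variables are renamed together with the free ones, so injectivity is what prevents
  capture.\<close>

lemma sat_rename_fm:
  assumes "inj f"
  shows "sat I (rename_fm f \<phi>) e = sat I \<phi> (\<lambda>i. e (f i))"
proof (induction \<phi> arbitrary: e)
  case (Ex i \<phi>)
  have "(\<lambda>j. (e(f i := a)) (f j)) = (\<lambda>j. e (f j))(i := a)" for a
    using assms by (auto simp: fun_eq_iff inj_eq)
  then show ?case by (simp add: Ex)
qed (auto simp: comp_def)

lemma sat_finite_support:
  "\<exists>N. \<forall>e e'. (\<forall>i<N. e i = e' i) \<longrightarrow> sat I \<phi> e = sat I \<phi> e'"
proof (induction \<phi>)
  case (Atom r vs)
  have "\<exists>N. \<forall>i\<in>set vs. i < N"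
    by (metis finite_nat_set_iff_bounded finite_set)
  then obtain N where N: "\<forall>i\<in>set vs. i < N" ..
  have "map e vs = map e' vs" if "\<forall>i<N. e i = e' i" for e e' :: "nat \<Rightarrow> 'a"
    using N that by auto
  then show ?case by (metis sat.simps(1))
next
  case (Eq i j)
  show ?case by (rule exI[of _ "Suc (max i j)"]) auto
next
  case (Neg \<phi>)
  then show ?case by simp
next
  case (Conj \<phi> \<psi>)
  then obtain N N' where N: "\<forall>e e'. (\<forall>i<N. e i = e' i) \<longrightarrow> sat I \<phi> e = sat I \<phi> e'"
     "\<forall>e e'. (\<forall>i<N'. e i = e' i) \<longrightarrow> sat I \<psi> e = sat I \<psi> e'" by auto
  show ?case
  proof (intro exI allI impI)
    fix e e' :: "nat \<Rightarrow> 'a" assume "\<forall>i<max N N'. e i = e' i"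
    then have "sat I \<phi> e = sat I \<phi> e'" "sat I \<psi> e = sat I \<psi> e'" by (auto intro!: N[rule_format])
    then show "sat I (Conj \<phi> \<psi>) e = sat I (Conj \<phi> \<psi>) e'" by simp
  qed
next
  case (Ex i \<phi>)
  then obtain N where N: "\<forall>e e'. (\<forall>i<N. e i = e' i) \<longrightarrow> sat I \<phi> e = sat I \<phi> e'" by auto
  show ?case
  proof (intro exI allI impI)
    fix e e' :: "nat \<Rightarrow> 'a" assume "\<forall>i<N. e i = e' i"
    then have "sat I \<phi> (e(i := a)) = sat I \<phi> (e'(i := a))" for a by (auto intro!: N[rule_format])
    then show "sat I (Ex i \<phi>) e = sat I (Ex i \<phi>) e'" by simp
  qed
qed

section \<open>Definable predicates and definable functions of environments\<close>

locale fo_structure =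
  fixes I :: "'r \<Rightarrow> 'm list \<Rightarrow> bool"
begin

text \<open>Definable predicates on environments. Even variables carry the environment and odd
  variables the parameters, so parameters never clash with arguments. Quantifiers act in
  de Bruijn style: the bound value becomes entry 0 and the environment is shifted by one
  (by \<open>l\<close> for a quantifier over \<open>l\<close>-tuples).\<close>

definition dfn :: "((nat \<Rightarrow> 'm) \<Rightarrow> bool) \<Rightarrow> bool" where
  "dfn P \<longleftrightarrow> (\<exists>\<phi> p. \<forall>e. P e = sat I \<phi> (\<lambda>i. if even i then e (i div 2) else p (i div 2)))"

definition tm :: "((nat \<Rightarrow> 'm) \<Rightarrow> 'm) \<Rightarrow> bool" where
  "tm v \<longleftrightarrow> dfn (\<lambda>e. e 0 = v (\<lambda>i. e (Suc i)))"

definition tml :: "nat \<Rightarrow> ((nat \<Rightarrow> 'm) \<Rightarrow> 'm list) \<Rightarrow> bool" where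
  "tml l v \<longleftrightarrow> (\<forall>e. length (v e) = l) \<and> (\<forall>i<l. tm (\<lambda>e. v e ! i))"

text \<open>The map \<open>m\<close> reads each variable of the formula either as an environment
  entry (\<open>Inl\<close>) or as a parameter (\<open>Inr\<close>). No entry may be read twice,
  since moving entries to even and parameters to odd slots must be injective.\<close>

lemma dfnI:
  fixes m :: "nat \<Rightarrow> nat + 'm"
  assumes inj: "\<And>i j k. m i = Inl k \<Longrightarrow> m j = Inl k \<Longrightarrow> i = j"
    and eq: "\<And>e. P e = sat I \<phi> (\<lambda>i. case m i of Inl j \<Rightarrow> e j | Inr c \<Rightarrow> c)"
  shows "dfn P"
proof -
  define f where "f i = (case m i of Inl j \<Rightarrow> 2 * j | Inr c \<Rightarrow> 2 * i + 1)" for i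
  define p where "p i = (case m i of Inl j \<Rightarrow> undefined | Inr c \<Rightarrow> c)" for i
  have "inj f"
  proof (rule injI)
    fix i j assume h: "f i = f j"
    have *: "2 * a \<noteq> Suc (2 * b)" "Suc (2 * b) \<noteq> 2 * a" for a b :: nat by presburger+
    show "i = j"
      using h by (cases "m i"; cases "m j") (auto simp: f_def * intro: inj)
  qed
  have "P e = sat I (rename_fm f \<phi>) (\<lambda>i. if even i then e (i div 2) else p (i div 2))" for e
  proof -
    have "(\<lambda>i. case m i of Inl j \<Rightarrow> e j | Inr c \<Rightarrow> c)
        = (\<lambda>i. (\<lambda>i. if even i then e (i div 2) else p (i div 2)) (f i))"
      by (auto simp: f_def p_def fun_eq_iff split: sum.splits)
    then show ?thesis by (simp add: eq sat_rename_fm[OF \<open>inj f\<close>])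
  qed
  then show ?thesis unfolding dfn_def by blast
qed

lemma dfn_neg:
  assumes "dfn P" shows "dfn (\<lambda>e. \<not> P e)"
proof -
  from assms obtain \<phi> p where
    P: "\<And>e. P e = sat I \<phi> (\<lambda>i. if even i then e (i div 2) else p (i div 2))"
    unfolding dfn_def by blast
  show ?thesis unfolding dfn_def by (rule exI[of _ "Neg \<phi>"], rule exI[of _ p]) (simp add: P)
qed

lemma dfn_conj:
  assumes "dfn P" "dfn Q" shows "dfn (\<lambda>e. P e \<and> Q e)"
proof -
  from assms(1) obtain \<phi> p where
    P: "\<And>e. P e = sat I \<phi> (\<lambda>i. if even i then e (i div 2) else p (i div 2))"
    unfolding dfn_def by blast
  from assms(2) obtain \<psi> q where
    Q: "\<And>e. Q e = sat I \<psi> (\<lambda>i. if even i then e (i div 2) else q (i div 2))"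
    unfolding dfn_def by blast
  \<comment> \<open>The two parameter lists are interleaved: those of \<open>\<phi>\<close> move to
    the slots 1 mod 4, those of \<open>\<psi>\<close> to the slots 3 mod 4, while the shared
    environment stays on the even slots.\<close>
  define f :: "nat \<Rightarrow> nat" where "f i = (if even i then i else 4 * (i div 2) + 1)" for i
  define g :: "nat \<Rightarrow> nat" where "g i = (if even i then i else 4 * (i div 2) + 3)" for i
  define r where "r i = (if even i then p (i div 2) else q (i div 2))" for i
  have *: "4 * a + 1 \<noteq> 2 * b" "4 * a + 3 \<noteq> 2 * b" for a b :: nat by presburger+
  have "inj f" "inj g"
    by (auto simp: f_def g_def inj_def *[simplified] *[symmetric, simplified] elim!: evenE oddE)
  have "(P e \<and> Q e) = sat I (Conj (rename_fm f \<phi>) (rename_fm g \<psi>))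
      (\<lambda>i. if even i then e (i div 2) else r (i div 2))" for e
  proof -
    have 1: "(\<lambda>i. (\<lambda>i. if even i then e (i div 2) else r (i div 2)) (f i))
        = (\<lambda>i. if even i then e (i div 2) else p (i div 2))"
      by (auto simp: f_def r_def fun_eq_iff elim!: oddE)
    have "(4 * j + 3) div 2 = 2 * j + (1::nat)" for j by presburger
    then have 2: "(\<lambda>i. (\<lambda>i. if even i then e (i div 2) else r (i div 2)) (g i))
        = (\<lambda>i. if even i then e (i div 2) else q (i div 2))"
      by (auto simp: g_def r_def fun_eq_iff elim!: oddE)
    show ?thesis
      by (simp only: sat.simps sat_rename_fm[OF \<open>inj f\<close>] sat_rename_fm[OF \<open>inj g\<close>] 1 2 P Q)
  qed
  then show ?thesis unfolding dfn_def by blast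
qed

lemma dfn_disj:
  assumes "dfn P" "dfn Q" shows "dfn (\<lambda>e. P e \<or> Q e)"
proof -
  have "dfn (\<lambda>e. \<not> (\<not> P e \<and> \<not> Q e))" by (intro dfn_neg dfn_conj assms)
  then show ?thesis by simp
qed

lemma dfn_imp:
  assumes "dfn P" "dfn Q" shows "dfn (\<lambda>e. P e \<longrightarrow> Q e)"
  unfolding imp_conv_disj by (intro dfn_neg dfn_disj assms)

lemma dfn_var_eq: "dfn (\<lambda>e. e i = e j)"
  unfolding dfn_def by (rule exI[of _ "Eq (2 * i) (2 * j)"]) simp

lemma dfn_bool: "dfn (\<lambda>e. b)"
proof (cases b)
  case True then show ?thesis using dfn_var_eq[of 0 0] by simp
next
  case False then show ?thesis using dfn_neg[OF dfn_var_eq[of 0 0]] by simp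
qed

lemma dfn_ex:
  assumes "dfn (\<lambda>e. P (e 0) (\<lambda>i. e (Suc i)))"
  shows "dfn (\<lambda>e. \<exists>a. P a e)"
proof -
  from assms obtain \<phi> p where
    P: "\<And>e. P (e 0) (\<lambda>i. e (Suc i)) = sat I \<phi> (\<lambda>i. if even i then e (i div 2) else p (i div 2))"
    unfolding dfn_def by blast
  \<comment> \<open>The quantified entry 0 moves to the odd slot 1. The other entries move down by
    one place, and the parameters move up by one to free that slot.\<close>
  define f :: "nat \<Rightarrow> nat" where "f i = (if i = 0 then 1 else if even i then i - 2 else i + 2)" for i
  define q where "q i = (if i = 0 then undefined else p (i - 1))" for i
  have "inj f" unfolding f_def inj_def by presburger
  have "(\<exists>a. P a e) = sat I (Ex 1 (rename_fm f \<phi>)) (\<lambda>i. if even i then e (i div 2) else q (i div 2))" for e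
  proof -
    have 1: "(\<lambda>i. ((\<lambda>i. if even i then e (i div 2) else q (i div 2))(1 := a)) (f i))
        = (\<lambda>i. if even i then (case_nat a e) (i div 2) else p (i div 2))" for a
    proof
      fix i
      consider "i = 0" | j where "i = 2 * Suc j" | j where "i = 2 * j + 1"
        by (metis evenE oddE not0_implies_Suc mult_0_right)
      then show "((\<lambda>i. if even i then e (i div 2) else q (i div 2))(1 := a)) (f i)
        = (if even i then (case_nat a e) (i div 2) else p (i div 2))"
        by cases (auto simp: f_def q_def)
    qed
    have 2: "P a e = sat I \<phi> (\<lambda>i. if even i then (case_nat a e) (i div 2) else p (i div 2))" for a
      using P[of "case_nat a e"] by simp
    show ?thesis
      by (simp only: sat.simps sat_rename_fm[OF \<open>inj f\<close>] 1 2)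
  qed
  then show ?thesis unfolding dfn_def by blast
qed

lemma dfn_all:
  assumes "dfn (\<lambda>e. P (e 0) (\<lambda>i. e (Suc i)))"
  shows "dfn (\<lambda>e. \<forall>a. P a e)"
proof -
  have "dfn (\<lambda>e. \<not> (\<exists>a. \<not> P a e))" by (intro dfn_neg dfn_ex assms)
  then show ?thesis by simp
qed

lemma dfn_exl:
  assumes "dfn (\<lambda>e. P (map e [0..<l]) (\<lambda>i. e (i + l)))"
  shows "dfn (\<lambda>e. \<exists>y. length y = l \<and> P y e)"
  using assms
proof (induction l arbitrary: P)
  case 0
  then show ?case by simp
next
  case (Suc l)
  have "dfn (\<lambda>e. \<exists>y. length y = l \<and> (\<exists>a. P (a # y) e))"
  proof (rule Suc.IH, rule dfn_ex)
    have "map e [0..<Suc l] = e 0 # map (\<lambda>i. e (Suc i)) [0..<l]" for e :: "nat \<Rightarrow> 'm"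
      by (simp add: map_upt_Suc del: upt_Suc)
    then show "dfn (\<lambda>e. P (e 0 # map (\<lambda>i. e (Suc i)) [0..<l]) (\<lambda>i. e (Suc (i + l))))"
      using Suc.prems by simp
  qed
  moreover have "(\<exists>y. length y = l \<and> (\<exists>a. P (a # y) e)) = (\<exists>y. length y = Suc l \<and> P y e)" for e
    by (auto simp: length_Suc_conv)
  ultimately show ?case by simp
qed

lemma dfn_alll:
  assumes "dfn (\<lambda>e. P (map e [0..<l]) (\<lambda>i. e (i + l)))"
  shows "dfn (\<lambda>e. \<forall>y. length y = l \<longrightarrow> P y e)"
proof -
  have "dfn (\<lambda>e. \<not> (\<exists>y. length y = l \<and> \<not> P y e))" by (intro dfn_neg dfn_exl assms)
  then show ?thesis by simp
qed

lemma dfn_all_less: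
  "(\<And>i. i < (n::nat) \<Longrightarrow> dfn (P i)) \<Longrightarrow> dfn (\<lambda>e. \<forall>i<n. P i e)"
proof (induction n)
  case 0 then show ?case by (simp add: dfn_bool)
next
  case (Suc n)
  have "(\<lambda>e. \<forall>i<Suc n. P i e) = (\<lambda>e. (\<forall>i<n. P i e) \<and> P n e)" by (auto simp: less_Suc_eq)
  then show ?case using Suc by (simp add: dfn_conj)
qed

text \<open>Here \<open>\<sigma>\<close> may identify variables, which \<open>sat_rename_fm\<close>
  does not allow. Since truth depends on finitely many entries, the values
  \<open>e (\<sigma> i)\<close> are copied into a tuple of fresh quantified variables
  instead.\<close>

lemma dfn_rename:
  assumes "dfn P" shows "dfn (\<lambda>e. P (\<lambda>i. e (\<sigma> i)))"
proof -
  from assms obtain \<phi> p where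
    P: "\<And>e. P e = sat I \<phi> (\<lambda>i. if even i then e (i div 2) else p (i div 2))"
    unfolding dfn_def by blast
  obtain N where N: "\<forall>e e'. (\<forall>i<N. e i = e' i) \<longrightarrow> sat I \<phi> e = sat I \<phi> e'"
    using sat_finite_support[of I \<phi>] by blast
  have supp: "P e = P e'" if "\<forall>i<N. e i = e' i" for e e'
    unfolding P by (rule N[rule_format]) (use that in auto)
  have "dfn (\<lambda>e. \<exists>y. length y = N \<and> ((\<forall>i<N. y ! i = e (\<sigma> i)) \<and> P (\<lambda>i. if i < N then y ! i else e i)))"
  proof (rule dfn_exl, rule dfn_conj)
    show "dfn (\<lambda>e. \<forall>i<N. map e [0..<N] ! i = e (\<sigma> i + N))"
      by (rule dfn_all_less) (simp add: dfn_var_eq)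
    have "P (\<lambda>i. if i < N then map e [0..<N] ! i else e (i + N)) = P e" for e
      by (rule supp) simp
    then show "dfn (\<lambda>e. P (\<lambda>i. if i < N then map e [0..<N] ! i else e (i + N)))"
      using assms by simp
  qed
  moreover have "(\<exists>y. length y = N \<and> ((\<forall>i<N. y ! i = e (\<sigma> i)) \<and> P (\<lambda>i. if i < N then y ! i else e i)))
     = P (\<lambda>i. e (\<sigma> i))" for e
  proof
    assume "\<exists>y. length y = N \<and> ((\<forall>i<N. y ! i = e (\<sigma> i)) \<and> P (\<lambda>i. if i < N then y ! i else e i))"
    then show "P (\<lambda>i. e (\<sigma> i))" using supp by (smt (verit, ccfv_SIG))
  next
    assume "P (\<lambda>i. e (\<sigma> i))"
    then have "P (\<lambda>i. if i < N then map (\<lambda>i. e (\<sigma> i)) [0..<N] ! i else e i)"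
      by (subst supp[of _ "\<lambda>i. e (\<sigma> i)"]) simp_all
    then show "\<exists>y. length y = N \<and> ((\<forall>i<N. y ! i = e (\<sigma> i)) \<and> P (\<lambda>i. if i < N then y ! i else e i))"
      by (intro exI[of _ "map (\<lambda>i. e (\<sigma> i)) [0..<N]"]) simp
  qed
  ultimately show ?thesis by simp
qed

text \<open>Turns all entries but the first into parameters; this is what makes fibres of definable
  relations definable.\<close>

lemma dfn_fix:
  assumes "dfn P" shows "dfn (\<lambda>e. P (case_nat (e 0) e0))"
proof -
  from assms obtain \<phi> p where
    P: "\<And>e. P e = sat I \<phi> (\<lambda>i. if even i then e (i div 2) else p (i div 2))"
    unfolding dfn_def by blast
  show ?thesis
  proof (rule dfnI[where \<phi> = \<phi> and m = "\<lambda>i. if i = 0 then Inl 0 else if even i then Inr (e0 (i div 2 - 1)) else Inr (p (i div 2))"])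
    fix e
    have "(\<lambda>i. if even i then (case_nat (e 0) e0) (i div 2) else p (i div 2)) =
       (\<lambda>i. case if i = 0 then Inl 0 else if even i then Inr (e0 (i div 2 - 1)) else Inr (p (i div 2))
             of Inl j \<Rightarrow> e j | Inr c \<Rightarrow> c)"
      by (auto simp: fun_eq_iff elim!: evenE split: nat.splits)
    then show "P (case_nat (e 0) e0) = sat I \<phi> (\<lambda>i. case if i = 0 then Inl 0 else if even i then Inr (e0 (i div 2 - 1)) else Inr (p (i div 2))
             of Inl j \<Rightarrow> e j | Inr c \<Rightarrow> c)"
      unfolding P by simp
  qed (auto split: if_splits)
qed

lemma tm_rename:
  assumes "tm v" shows "tm (\<lambda>e. v (\<lambda>i. e (\<sigma> i)))"
  using dfn_rename[OF assms[unfolded tm_def], of "case_nat 0 (\<lambda>i. Suc (\<sigma> i))"]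
  by (simp add: tm_def)

lemma tml_rename:
  assumes "tml l v" shows "tml l (\<lambda>e. v (\<lambda>i. e (\<sigma> i)))"
  unfolding tml_def
proof (intro conjI allI impI)
  fix j assume "j < l"
  then have "tm (\<lambda>e. v e ! j)" using assms by (simp add: tml_def)
  then show "tm (\<lambda>e. v (\<lambda>i. e (\<sigma> i)) ! j)" by (rule tm_rename)
qed (use assms in \<open>simp add: tml_def\<close>)

lemma tm_var: "tm (\<lambda>e. e i)"
  unfolding tm_def by (rule dfn_var_eq)

lemma tm_const: "tm (\<lambda>e. c)"
  unfolding tm_def
  by (rule dfnI[where \<phi> = "Eq 0 1" and m = "\<lambda>i. if i = 0 then Inl 0 else Inr c"])
    (auto split: if_splits)

lemma dfn_sub1:
  assumes "dfn (\<lambda>e. Q (e 0) (\<lambda>i. e (Suc i)))" "tm v"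
  shows "dfn (\<lambda>e. Q (v e) e)"
proof -
  have "dfn (\<lambda>e. \<exists>a. a = v e \<and> Q a e)"
    using assms by (intro dfn_ex dfn_conj) (simp_all only: tm_def)
  then show ?thesis by simp
qed

lemma dfn_eq:
  assumes "tm v" "tm w" shows "dfn (\<lambda>e. v e = w e)"
  using assms(2)[unfolded tm_def] assms(1) by (rule dfn_sub1)

lemma dfn_eql:
  assumes "tml n v" "tml n w" shows "dfn (\<lambda>e. v e = w e)"
proof -
  have "dfn (\<lambda>e. \<forall>i<n. v e ! i = w e ! i)"
    using assms by (intro dfn_all_less dfn_eq) (auto simp: tml_def)
  moreover have "(v e = w e) = (\<forall>i<n. v e ! i = w e ! i)" for e
    using assms by (auto simp: tml_def list_eq_iff_nth_eq)
  ultimately show ?thesis by simp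
qed

lemma tml_vars: "tml l (\<lambda>e. map (\<lambda>i. e (\<sigma> i)) [0..<l])"
  by (auto simp: tml_def tm_var)

lemma tml_const: "length c = l \<Longrightarrow> tml l (\<lambda>e. c)"
  by (auto simp: tml_def tm_const)

lemma tml_Nil: "tml 0 (\<lambda>e. [])"
  by (auto simp: tml_def)

lemma tml_Cons: "tm v \<Longrightarrow> tml l w \<Longrightarrow> tml (Suc l) (\<lambda>e. v e # w e)"
  unfolding tml_def by (auto simp: less_Suc_eq_0_disj)

lemma tml_append:
  assumes "tml k v" "tml l w" shows "tml (k + l) (\<lambda>e. v e @ w e)"
proof -
  have "tm (\<lambda>e. (v e @ w e) ! i)" if "i < k + l" for i
    using assms that by (cases "i < k") (auto simp: tml_def nth_append)
  then show ?thesis using assms by (simp add: tml_def)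
qed

lemma tml_take: "tml k v \<Longrightarrow> m \<le> k \<Longrightarrow> tml m (\<lambda>e. take m (v e))"
  by (auto simp: tml_def)

lemma tm_nth: "tml k v \<Longrightarrow> i < k \<Longrightarrow> tm (\<lambda>e. v e ! i)"
  by (auto simp: tml_def)

lemma dfn_subl:
  assumes "dfn (\<lambda>e. Q (map e [0..<l]) (\<lambda>i. e (i + l)))" "tml l v"
  shows "dfn (\<lambda>e. Q (v e) e)"
proof -
  have "dfn (\<lambda>e. \<exists>y. length y = l \<and> (y = v e \<and> Q y e))"
    by (rule dfn_exl, rule dfn_conj, rule dfn_eql[where n = l])
      (use assms tml_rename[OF assms(2)] tml_vars[of l "\<lambda>i. i"] in auto)
  then show ?thesis using assms(2) by (simp add: tml_def)
qed

lemma tm_sub1: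
  assumes "tm (\<lambda>e. f (e 0) (\<lambda>i. e (Suc i)))" "tm v"
  shows "tm (\<lambda>e. f (v e) e)"
proof -
  have "dfn (\<lambda>e. e (Suc 0) = f (e 0) (\<lambda>i. e (Suc (Suc i))))"
    using dfn_rename[OF assms(1)[unfolded tm_def], of "\<lambda>i. case i of 0 \<Rightarrow> Suc 0 | Suc 0 \<Rightarrow> 0 | Suc (Suc j) \<Rightarrow> Suc (Suc j)"]
    by simp
  then have "dfn (\<lambda>e. e 0 = f (v (\<lambda>i. e (Suc i))) (\<lambda>i. e (Suc i)))"
    by (rule dfn_sub1[where Q = "\<lambda>a e. e 0 = f a (\<lambda>i. e (Suc i))"]) (rule tm_rename[OF assms(2)])
  then show ?thesis by (simp add: tm_def)
qed

lemma tm_THE: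
  assumes "\<And>e. \<exists>!a. P a e" "dfn (\<lambda>e. P (e 0) (\<lambda>i. e (Suc i)))"
  shows "tm (\<lambda>e. THE a. P a e)"
proof -
  have "(a = (THE a. P a e)) = P a e" for a e
    using assms(1)[of e] by (metis the_equality theI')
  then show ?thesis using assms(2) by (simp add: tm_def)
qed

lemma dfn_mem:
  assumes "definable I n D" "tml n v" shows "dfn (\<lambda>e. v e \<in> D)"
proof -
  from assms(1) obtain \<phi> p where D: "D = {xs. length xs = n \<and> sat I \<phi> (\<lambda>i. if i < n then xs ! i else p i)}"
    unfolding definable_def by blast
  have "dfn (\<lambda>e. map e [0..<n] \<in> D)"
  proof (rule dfnI[where \<phi> = \<phi> and m = "\<lambda>i. if i < n then Inl i else Inr (p i)"])
    fix e :: "nat \<Rightarrow> 'm"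
    have "(\<lambda>i. if i < n then map e [0..<n] ! i else p i) =
          (\<lambda>i. case if i < n then Inl i else Inr (p i) of Inl j \<Rightarrow> e j | Inr c \<Rightarrow> c)" by auto
    then show "(map e [0..<n] \<in> D) = sat I \<phi> (\<lambda>i. case if i < n then Inl i else Inr (p i) of Inl j \<Rightarrow> e j | Inr c \<Rightarrow> c)"
      unfolding D by simp
  qed (auto split: if_splits)
  then show ?thesis using assms(2) by (rule dfn_subl[where Q = "\<lambda>y e. y \<in> D"])
qed

lemma definableI:
  assumes "dfn (\<lambda>e. P (map e [0..<n]))"
  shows "definable I n {xs. length xs = n \<and> P xs}"
proof -
  from assms obtain \<phi> p where
    P: "\<And>e. P (map e [0..<n]) = sat I \<phi> (\<lambda>i. if even i then e (i div 2) else p (i div 2))"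
    unfolding dfn_def by blast
  \<comment> \<open>The tuple goes to the variables below \<open>n\<close> and everything else is
    shifted above them. Entries beyond the tuple receive a dummy value, as \<open>P\<close> sees
    only the first \<open>n\<close>.\<close>
  define f where "f i = (if even i \<and> i div 2 < n then i div 2 else i + n)" for i
  have "inj f" unfolding f_def inj_def by (auto elim!: evenE)
  define q where "q i = (if even (i - n) then undefined else p ((i - n) div 2))" for i
  have "P xs = sat I (rename_fm f \<phi>) (\<lambda>i. if i < n then xs ! i else q i)" if "length xs = n" for xs
  proof -
    have 1: "xs = map (\<lambda>i. if i < n then xs ! i else undefined) [0..<n]"
      using that by (auto simp: list_eq_iff_nth_eq)
    have 2: "(\<lambda>i. (\<lambda>i. if i < n then xs ! i else q i) (f i)) =
       (\<lambda>i. if even i then (\<lambda>i. if i < n then xs ! i else undefined) (i div 2) else p (i div 2))"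
      by (auto simp: f_def q_def fun_eq_iff)
    show ?thesis
      by (subst 1, subst P) (simp only: sat_rename_fm[OF \<open>inj f\<close>] 2)
  qed
  then have "{xs. length xs = n \<and> P xs} = {xs. length xs = n \<and> sat I (rename_fm f \<phi>) (\<lambda>i. if i < n then xs ! i else q i)}"
    by auto
  then show ?thesis unfolding definable_def by blast
qed

lemma dfn_bexl:
  assumes "definable I k Y" "dfn (\<lambda>e. P (map e [0..<k]) (\<lambda>i. e (i + k)))"
  shows "dfn (\<lambda>e. \<exists>y\<in>Y. P y e)"
proof -
  have "dfn (\<lambda>e. \<exists>y. length y = k \<and> (y \<in> Y \<and> P y e))"
    by (rule dfn_exl, rule dfn_conj, rule dfn_mem[OF assms(1)])
      (use assms(2) tml_vars[of k "\<lambda>i. i"] in auto)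
  moreover have "y \<in> Y \<Longrightarrow> length y = k" for y using assms(1) by (auto simp: definable_def)
  then have "(\<exists>y. length y = k \<and> (y \<in> Y \<and> P y e)) = (\<exists>y\<in>Y. P y e)" for e by blast
  ultimately show ?thesis by simp
qed

lemma dfn_balll:
  assumes "definable I k Y" "dfn (\<lambda>e. P (map e [0..<k]) (\<lambda>i. e (i + k)))"
  shows "dfn (\<lambda>e. \<forall>y\<in>Y. P y e)"
proof -
  have "dfn (\<lambda>e. \<not> (\<exists>y\<in>Y. \<not> P y e))" by (intro dfn_neg dfn_bexl[OF assms(1)] assms(2))
  then show ?thesis by simp
qed

text \<open>This rule and its variants serve as introduction rules: definability is checked once, on
  fixed variables, and then transferred to arbitrary definable arguments. In
  \<open>dfn_inst1\<close> and \<open>dfn_instl\<close>, \<open>\<sigma>\<close> says how the rest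
  of the environment is read.\<close>

lemma dfn_inst1:
  assumes "dfn (\<lambda>e. P (e 0) (\<lambda>i. e (Suc i)))" "tm v"
  shows "dfn (\<lambda>e. P (v e) (\<lambda>i. e (\<sigma> i)))"
  using dfn_rename[OF assms(1), of "case_nat 0 (\<lambda>i. Suc (\<sigma> i))"] assms(2)
  by (intro dfn_sub1[where Q = "\<lambda>a e. P a (\<lambda>i. e (\<sigma> i))"]) simp_all

lemma dfn_instl:
  assumes "dfn (\<lambda>e. P (map e [0..<l]) (\<lambda>i. e (i + l)))" "tml l v"
  shows "dfn (\<lambda>e. P (v e) (\<lambda>i. e (\<sigma> i)))"
proof -
  have 1: "map (\<lambda>i. e (if i < l then i else \<sigma> (i - l) + l)) [0..<l] = map e [0..<l]" for e :: "nat \<Rightarrow> 'm"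
    by simp
  have "dfn (\<lambda>e. P (map e [0..<l]) (\<lambda>i. e (\<sigma> i + l)))"
    using dfn_rename[OF assms(1), of "\<lambda>i. if i < l then i else \<sigma> (i - l) + l"] unfolding 1 by simp
  then show ?thesis
    using assms(2) by (rule dfn_subl[where Q = "\<lambda>a e. P a (\<lambda>i. e (\<sigma> i))"])
qed

lemma dfn_inst_11:
  assumes "dfn (\<lambda>e. D (e 0) (e (Suc 0)))" "tm v" "tm w"
  shows "dfn (\<lambda>e. D (v e) (w e))"
proof -
  have "dfn (\<lambda>e. D (e (Suc 0)) (e 0))"
    using dfn_rename[OF assms(1), of "\<lambda>i. Suc 0 - i"] by simp
  then have "dfn (\<lambda>e. D (e 0) (w (\<lambda>i. e (Suc i))))"
    by (rule dfn_sub1[where Q = "\<lambda>a e. D (e 0) a"]) (rule tm_rename[OF assms(3)])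
  then show ?thesis by (rule dfn_sub1[where Q = "\<lambda>a e. D a (w e)"]) (rule assms(2))
qed

lemma dfn_inst_1l:
  assumes "dfn (\<lambda>e. D (e 0) (map (\<lambda>i. e (Suc i)) [0..<l]))" "tm v" "tml l w"
  shows "dfn (\<lambda>e. D (v e) (w e))"
proof -
  have "dfn (\<lambda>e. D (e l) (map e [0..<l]))"
    using dfn_rename[OF assms(1), of "case_nat l (\<lambda>i. i)"] by simp
  then have "dfn (\<lambda>e. D (e 0) (w (\<lambda>i. e (Suc i))))"
    using tml_rename[OF assms(3)] by (intro dfn_subl[where Q = "\<lambda>a e. D (e 0) a"]) simp_all
  then show ?thesis by (rule dfn_sub1[where Q = "\<lambda>a e. D a (w e)"]) (rule assms(2))
qed

lemma dfn_inst_ll: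
  assumes "dfn (\<lambda>e. D (map e [0..<k]) (map (\<lambda>i. e (i + k)) [0..<l]))" "tml k v" "tml l w"
  shows "dfn (\<lambda>e. D (v e) (w e))"
proof -
  have eq: "map (\<lambda>i. e (if i < k then i + l else i - k)) [0..<k] = map (\<lambda>i. e (i + l)) [0..<k]" for e :: "nat \<Rightarrow> 'm"
    by simp
  have "dfn (\<lambda>e. D (map (\<lambda>i. e (i + l)) [0..<k]) (map e [0..<l]))"
    using dfn_rename[OF assms(1), of "\<lambda>i. if i < k then i + l else i - k"] unfolding eq by simp
  then have "dfn (\<lambda>e. D (map e [0..<k]) (w (\<lambda>i. e (i + k))))"
    by (rule dfn_subl[where Q = "\<lambda>z e. D (map e [0..<k]) z"]) (rule tml_rename[OF assms(3)])
  then show ?thesis by (rule dfn_subl[where Q = "\<lambda>y e. D y (w e)"]) (rule assms(2))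
qed

lemma dfn_inst_l11:
  assumes "dfn (\<lambda>e. K (map (\<lambda>i. e (Suc (Suc i))) [0..<k]) (e 0) (e (Suc 0)))" "tml k v" "tm s" "tm u"
  shows "dfn (\<lambda>e. K (v e) (s e) (u e))"
proof -
  have "dfn (\<lambda>e. K (map (\<lambda>i. e (Suc (Suc i))) [0..<k]) (e (Suc 0)) (e 0))"
    using dfn_rename[OF assms(1), of "\<lambda>i. if i < 2 then Suc 0 - i else i"] by simp
  then have "dfn (\<lambda>e. K (map (\<lambda>i. e (Suc i)) [0..<k]) (e 0) (u (\<lambda>i. e (Suc (i + k)))))"
    by (rule dfn_sub1[where Q = "\<lambda>b e. K (map (\<lambda>i. e (Suc i)) [0..<k]) (e 0) b"]) (rule tm_rename[OF assms(4)])
  then have "dfn (\<lambda>e. K (map e [0..<k]) (s (\<lambda>i. e (i + k))) (u (\<lambda>i. e (i + k))))"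
    by (rule dfn_sub1[where Q = "\<lambda>b e. K (map e [0..<k]) b (u (\<lambda>i. e (i + k)))"]) (rule tm_rename[OF assms(3)])
  then show ?thesis by (rule dfn_subl[where Q = "\<lambda>y e. K y (s e) (u e)"]) (rule assms(2))
qed

lemma tm_inst_11:
  assumes "tm (\<lambda>e. f (e 0) (e (Suc 0)))" "tm v" "tm w"
  shows "tm (\<lambda>e. f (v e) (w e))"
proof -
  have "tm (\<lambda>e. f (e (Suc 0)) (e 0))"
    using tm_rename[OF assms(1), of "\<lambda>i. Suc 0 - i"] by simp
  then have "tm (\<lambda>e. f (e 0) (w (\<lambda>i. e (Suc i))))"
    by (rule tm_sub1[where f = "\<lambda>a e. f (e 0) a"]) (rule tm_rename[OF assms(3)])
  then show ?thesis by (rule tm_sub1[where f = "\<lambda>a e. f a (w e)"]) (rule assms(2))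
qed

lemma tml_inst_11:
  assumes "tml n (\<lambda>e. f (e 0) (e (Suc 0)))" "tm v" "tm w"
  shows "tml n (\<lambda>e. f (v e) (w e))"
proof -
  have "length (f a b) = n" for a b
    using assms(1)[unfolded tml_def, THEN conjunct1, rule_format, of "case_nat a (\<lambda>_. b)"] by simp
  moreover have "tm (\<lambda>e. f (v e) (w e) ! i)" if "i < n" for i
    using assms(1) that by (intro tm_inst_11[where f = "\<lambda>a b. f a b ! i", OF _ assms(2,3)]) (simp add: tml_def)
  ultimately show ?thesis by (simp add: tml_def)
qed

end

section \<open>Definably complete, locally o-minimal ordered groups\<close>

locale dclo_group = fo_structure I for I :: "'r \<Rightarrow> 'm::{group_add,linorder} list \<Rightarrow> bool" +
  assumes ogroup: "ordered_group_dense_no_endpoints TYPE('m)"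
    and expands: "expands_ordered_group I"
    and complete: "definably_complete I"
    and locally_omin: "locally_o_minimal I"
begin

text \<open>The class \<open>group_add\<close> carries no commutativity, so left and right
  cancellation are both recorded. Closeness is later expressed by the pair \<open>a < b + d\<close>,
  \<open>b < a + d\<close>, which involves no difference.\<close>

lemma add_less_right_iff: "(a::'m) + c < b + c \<longleftrightarrow> a < b"
  and add_less_left_iff: "c + (a::'m) < c + b \<longleftrightarrow> a < b"
  using ogroup unfolding ordered_group_dense_no_endpoints_def
  by (metis less_irrefl less_trans linorder_less_linear)+

lemma add_le_right_iff: "(a::'m) + c \<le> b + c \<longleftrightarrow> a \<le> b"
  and add_le_left_iff: "c + (a::'m) \<le> c + b \<longleftrightarrow> a \<le> b"
  by (simp_all add: not_less[symmetric] add_less_right_iff add_less_left_iff)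

lemma dense_between: "(a::'m) < b \<Longrightarrow> \<exists>c. a < c \<and> c < b"
  and ex_less: "\<exists>b. b < (a::'m)"
  and ex_greater: "\<exists>b. (a::'m) < b"
  using ogroup unfolding ordered_group_dense_no_endpoints_def by blast+

lemma interval_subset:
  fixes a :: 'm
  assumes "{c<..<d} \<subseteq> {a<..<b}" "c < d" shows "a \<le> c \<and> d \<le> b"
proof (rule ccontr)
  assume "\<not> (a \<le> c \<and> d \<le> b)"
  then have "c < min a d \<or> max c b < d" using assms(2) by auto
  then obtain z where "c < z \<and> z < d \<and> (z < a \<or> b < z)"
    using dense_between[of c "min a d"] dense_between[of "max c b" d] by auto
  then show False using assms(1) by force
qed

lemma less_add_pos: "0 < s \<Longrightarrow> (a::'m) < a + s"
  using add_less_left_iff[of a 0 s] by simp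

lemma diff_pos_less: "0 < s \<Longrightarrow> (a::'m) - s < a"
  using add_less_right_iff[of "a - s" s a] less_add_pos[of s a] by simp

lemma neg_less_iff: "- (a::'m) < - b \<longleftrightarrow> b < a"
proof -
  have "- a < - b \<longleftrightarrow> a + - a < a + - b" by (simp only: add_less_left_iff)
  also have "\<dots> \<longleftrightarrow> a + - a + b < a + - b + b" by (simp only: add_less_right_iff)
  finally show ?thesis by (simp add: add.assoc)
qed

lemma neg_le_iff: "- (a::'m) \<le> - b \<longleftrightarrow> b \<le> a"
  by (simp add: not_less[symmetric] neg_less_iff)

text \<open>A substitute for division by two: density splits \<open>s = c + d\<close> with
  \<open>c\<close> and \<open>d\<close> positive, and \<open>h\<close> is taken below both.\<close>

lemma half_exists:
  assumes "0 < (s::'m)" shows "\<exists>h>0. h + h < s"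
proof -
  obtain c where c: "0 < c" "c < s" using dense_between[OF assms] by blast
  define d where "d = - c + s"
  have s: "c + d = s" by (simp add: d_def)
  have d: "0 < d" using c(2) add_less_left_iff[of c 0 d] s by simp
  obtain h where h: "0 < h" "h < min c d" using dense_between[of 0 "min c d"] c d by auto
  have "h + h < c + h" using h by (simp add: add_less_right_iff)
  also have "c + h < c + d" using h by (simp add: add_less_left_iff)
  finally show ?thesis using h s by auto
qed

text \<open>The window from \<open>p - h\<close> to \<open>p + h\<close> with
  \<open>h + h < s\<close> works. In use, \<open>a\<close> and \<open>b\<close> both lie in the
  window, and the conclusion applied both ways says that they are less than \<open>s\<close>
  apart.\<close>

lemma small_nbhd:
  assumes "0 < (s::'m)"
  shows "\<exists>l r. l < p \<and> p < r \<and> (\<forall>a b. a \<le> r \<longrightarrow> l \<le> b \<longrightarrow> a < b + s)"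
proof -
  obtain h where h: "0 < h" "h + h < s" using half_exists[OF assms] by blast
  have "a < b + s" if "a \<le> p + h" "p - h \<le> b" for a b
  proof -
    note that(1)
    also have "p + h = p - h + (h + h)" by (simp add: add.assoc[symmetric])
    also have "\<dots> < p - h + s" using h by (simp add: add_less_left_iff)
    also have "\<dots> \<le> b + s" using that by (simp add: add_le_right_iff)
    finally show ?thesis .
  qed
  then show ?thesis using less_add_pos[OF h(1), of p] diff_pos_less[OF h(1), of p] by blast
qed

lemma pos_gap:
  assumes "(a::'m) < b" obtains d where "0 < d" "a + d \<le> b"
proof
  show "0 < - a + b" using assms add_less_left_iff[of a 0 "- a + b"] by simp
  show "a + (- a + b) \<le> b" by simp
qed

lemma pos_min:
  assumes "0 < (d::'m)" "0 < d'" "a + d \<le> b" "a' + d' \<le> b'"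
  shows "\<exists>c>0. a + c \<le> b \<and> a' + c \<le> b'"
proof (intro exI conjI)
  have "a + min d d' \<le> a + d" "a' + min d d' \<le> a' + d'" by (auto simp: add_le_left_iff)
  then show "a + min d d' \<le> b" "a' + min d d' \<le> b'" using assms by auto
qed (use assms in auto)

lemma tm_app: "tm (\<lambda>e. f (e 0)) \<Longrightarrow> tm v \<Longrightarrow> tm (\<lambda>e. f (v e))"
  by (rule tm_sub1[where f = "\<lambda>a e. f a"])

lemma dfn_less:
  assumes "tm v" "tm w" shows "dfn (\<lambda>e. v e < w e)"
proof -
  obtain rl where "\<forall>a b. I rl [a, b] \<longleftrightarrow> a < b" using expands unfolding expands_ordered_group_def
    by (elim exE conjE) (rule that)
  then have "dfn (\<lambda>e. e (Suc 0) < e 0)" unfolding dfn_def by (intro exI[of _ "Atom rl [2, 0]"]) simp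
  then have "dfn (\<lambda>e. e 0 < w (\<lambda>i. e (Suc i)))"
    by (rule dfn_sub1[where Q = "\<lambda>a e. e 0 < a"]) (rule tm_rename[OF assms(2)])
  then show ?thesis by (rule dfn_sub1[where Q = "\<lambda>a e. a < w e"]) (rule assms(1))
qed

lemma dfn_le: "tm v \<Longrightarrow> tm w \<Longrightarrow> dfn (\<lambda>e. v e \<le> w e)"
  unfolding not_less[symmetric] by (intro dfn_neg dfn_less)

lemma tm_add:
  assumes "tm v" "tm w" shows "tm (\<lambda>e. v e + w e)"
proof -
  obtain rp where "\<forall>a b c. I rp [a, b, c] \<longleftrightarrow> c = a + b" using expands unfolding expands_ordered_group_def
    by (elim exE conjE) (rule that)
  then have "tm (\<lambda>e. e (Suc 0) + e 0)" unfolding tm_def dfn_def by (intro exI[of _ "Atom rp [2 * Suc (Suc 0), 2 * Suc 0, 2 * 0]"]) (simp, simp add: numeral_2_eq_2)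
  then have "tm (\<lambda>e. e 0 + w (\<lambda>i. e (Suc i)))"
    by (rule tm_sub1[where f = "\<lambda>a e. e 0 + a"]) (rule tm_rename[OF assms(2)])
  then show ?thesis by (rule tm_sub1[where f = "\<lambda>a e. a + w e"]) (rule assms(1))
qed

lemma tm_minus:
  assumes "tm v" shows "tm (\<lambda>e. - v e)"
proof -
  have "dfn (\<lambda>e. e 0 + v (\<lambda>i. e (Suc i)) = 0)"
    by (intro dfn_eq tm_add tm_var tm_const tm_rename[OF assms])
  then show ?thesis unfolding tm_def eq_neg_iff_add_eq_0 .
qed

lemmas dfn_rules = dfn_neg dfn_conj dfn_disj dfn_imp dfn_less dfn_le dfn_eq dfn_ex dfn_all
  tm_var tm_const tm_add tm_minus

definition dset :: "'m set \<Rightarrow> bool" where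
  "dset S \<longleftrightarrow> dfn (\<lambda>e. e 0 \<in> S)"

lemma dfn_in: "dset S \<Longrightarrow> tm v \<Longrightarrow> dfn (\<lambda>e. v e \<in> S)"
  unfolding dset_def by (rule dfn_sub1[where Q = "\<lambda>a e. a \<in> S"])

lemma dset_definable: "dset S \<Longrightarrow> definable I 1 {xs. length xs = 1 \<and> hd xs \<in> S}"
  unfolding dset_def by (rule definableI) simp

lemma dset_fibre:
  assumes "dfn (\<lambda>e. P (e 0) (\<lambda>i. e (Suc i)))" shows "dset {a. P a e}"
  unfolding dset_def using dfn_fix[OF assms, of e] by simp

lemma dset_Sup:
  assumes "dset S" "S \<noteq> {}" "\<And>y. y \<in> S \<Longrightarrow> y \<le> b"
  shows "\<exists>s. (\<forall>y\<in>S. y \<le> s) \<and> (\<forall>b. (\<forall>y\<in>S. y \<le> b) \<longrightarrow> s \<le> b)"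
proof -
  have "{y. [y] \<in> {xs. length xs = 1 \<and> hd xs \<in> S}} = S" by auto
  moreover have bdd: "\<exists>b. \<forall>y\<in>S. y \<le> b" using assms(3) by auto
  ultimately show ?thesis
    using complete[unfolded definably_complete_def, rule_format, OF dset_definable[OF assms(1)]] assms(2) bdd
    unfolding Let_def by (simp only: simp_thms)
qed

lemma dset_Inf:
  assumes "dset S" "S \<noteq> {}" "\<And>y. y \<in> S \<Longrightarrow> b \<le> y"
  shows "\<exists>s. (\<forall>y\<in>S. s \<le> y) \<and> (\<forall>b. (\<forall>y\<in>S. b \<le> y) \<longrightarrow> b \<le> s)"
proof -
  have "{y. [y] \<in> {xs. length xs = 1 \<and> hd xs \<in> S}} = S" by auto
  moreover have bdd: "\<exists>b. \<forall>y\<in>S. b \<le> y" using assms(3) by auto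
  ultimately show ?thesis
    using complete[unfolded definably_complete_def, rule_format, OF dset_definable[OF assms(1)]] assms(2) bdd
    unfolding Let_def by (simp only: simp_thms)
qed

section \<open>One-sided germs of definable sets, and definable sets without interior\<close>

lemma finite_pieces_right:
  fixes a :: 'm
  assumes "finite P" "\<forall>S\<in>P. (\<exists>p. S = {p}) \<or> (\<exists>c d. S = {c<..<d})"
  shows "\<exists>r>a. {a<..<r} \<subseteq> \<Union>P \<or> {a<..<r} \<inter> \<Union>P = {}"
  using assms
proof (induction P)
  case empty
  then show ?case using ex_greater by auto
next
  case (insert S P)
  then obtain r where r: "r > a" "{a<..<r} \<subseteq> \<Union>P \<or> {a<..<r} \<inter> \<Union>P = {}" by auto
  have "\<exists>q>a. {a<..<q} \<subseteq> S \<or> {a<..<q} \<inter> S = {}"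
  proof -
    consider p where "S = {p}" "p > a" | p where "S = {p}" "p \<le> a" | c d where "S = {c<..<d}" "d \<le> a"
      | c d where "S = {c<..<d}" "c > a" | c d where "S = {c<..<d}" "c \<le> a" "a < d"
      using insert.prems by (metis insertI1 not_less)
    then show ?thesis
    proof cases
      case 2 then show ?thesis using ex_greater[of a] by auto
    next
      case 3 then show ?thesis using ex_greater[of a] by fastforce
    qed fastforce+
  qed
  then obtain q where q: "q > a" "{a<..<q} \<subseteq> S \<or> {a<..<q} \<inter> S = {}" by auto
  show ?case
    by (rule exI[of _ "min r q"]) (use r q in auto)
qed

lemma finite_pieces_left:
  fixes a :: 'm
  assumes "finite P" "\<forall>S\<in>P. (\<exists>p. S = {p}) \<or> (\<exists>c d. S = {c<..<d})"
  shows "\<exists>r<a. {r<..<a} \<subseteq> \<Union>P \<or> {r<..<a} \<inter> \<Union>P = {}"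
  using assms
proof (induction P)
  case empty
  then show ?case using ex_less by auto
next
  case (insert S P)
  then obtain r where r: "r < a" "{r<..<a} \<subseteq> \<Union>P \<or> {r<..<a} \<inter> \<Union>P = {}" by auto
  have "\<exists>q<a. {q<..<a} \<subseteq> S \<or> {q<..<a} \<inter> S = {}"
  proof -
    consider p where "S = {p}" "p < a" | p where "S = {p}" "p \<ge> a" | c d where "S = {c<..<d}" "c \<ge> a"
      | c d where "S = {c<..<d}" "d < a" | c d where "S = {c<..<d}" "c < a" "a \<le> d"
      using insert.prems by (metis insertI1 not_less)
    then show ?thesis
    proof cases
      case 2 then show ?thesis using ex_less[of a] by auto
    next
      case 3 then show ?thesis using ex_less[of a] by fastforce
    qed fastforce+
  qed
  then obtain q where q: "q < a" "{q<..<a} \<subseteq> S \<or> {q<..<a} \<inter> S = {}" by auto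
  show ?case
    by (rule exI[of _ "max r q"]) (use r q in auto)
qed

lemma dset_pieces:
  assumes "dset S"
  shows "\<exists>l u P. l < a \<and> a < u \<and> finite P \<and> (\<forall>S\<in>P. (\<exists>p. S = {p}) \<or> (\<exists>c d. S = {c<..<d})) \<and>
           S \<inter> {l<..<u} = \<Union>P"
proof -
  have "{y. [y] \<in> {xs. length xs = 1 \<and> hd xs \<in> S}} = S" by auto
  then show ?thesis
    using locally_omin[unfolded locally_o_minimal_def, rule_format, OF dset_definable[OF assms], of a] by auto
qed

text \<open>Local o-minimality enters the later arguments only through this dichotomy and its mirror
  image \<open>dset_left\<close>.\<close>

lemma dset_right:
  assumes "dset S"
  shows "\<exists>r>a. {a<..<r} \<subseteq> S \<or> {a<..<r} \<inter> S = {}"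
proof -
  obtain l u P where P: "l < a" "a < u" "finite P" "\<forall>S\<in>P. (\<exists>p. S = {p}) \<or> (\<exists>c d. S = {c<..<d})"
    "S \<inter> {l<..<u} = \<Union>P" using dset_pieces[OF assms, of a] by (elim exE conjE) (rule that)
  obtain r where r: "r > a" "{a<..<r} \<subseteq> \<Union>P \<or> {a<..<r} \<inter> \<Union>P = {}"
    using finite_pieces_right[OF P(3,4), of a] by (elim exE conjE) (rule that)
  show ?thesis
  proof (intro exI[of _ "min r u"] conjI)
    have "{a<..<min r u} \<inter> S = {a<..<min r u} \<inter> \<Union>P" unfolding P(5)[symmetric] using P(1,2) by auto
    moreover have "{a<..<min r u} \<subseteq> \<Union>P \<or> {a<..<min r u} \<inter> \<Union>P = {}" using r(2) by auto
    ultimately show "{a<..<min r u} \<subseteq> S \<or> {a<..<min r u} \<inter> S = {}" by blast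
  qed (use r P(1,2) in auto)
qed

lemma dset_left:
  assumes "dset S"
  shows "\<exists>r<a. {r<..<a} \<subseteq> S \<or> {r<..<a} \<inter> S = {}"
proof -
  obtain l u P where P: "l < a" "a < u" "finite P" "\<forall>S\<in>P. (\<exists>p. S = {p}) \<or> (\<exists>c d. S = {c<..<d})"
    "S \<inter> {l<..<u} = \<Union>P" using dset_pieces[OF assms, of a] by (elim exE conjE) (rule that)
  obtain r where r: "r < a" "{r<..<a} \<subseteq> \<Union>P \<or> {r<..<a} \<inter> \<Union>P = {}"
    using finite_pieces_left[OF P(3,4), of a] by (elim exE conjE) (rule that)
  show ?thesis
  proof (intro exI[of _ "max r l"] conjI)
    have "{max r l<..<a} \<inter> S = {max r l<..<a} \<inter> \<Union>P" unfolding P(5)[symmetric] using P(1,2) by auto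
    moreover have "{max r l<..<a} \<subseteq> \<Union>P \<or> {max r l<..<a} \<inter> \<Union>P = {}" using r(2) by auto
    ultimately show "{max r l<..<a} \<subseteq> S \<or> {max r l<..<a} \<inter> S = {}" by blast
  qed (use r P(1,2) in auto)
qed

text \<open>For definable sets this amounts to being closed and discrete, by
  \<open>noint_isolated\<close>. Such a set may still be infinite.\<close>

definition noint :: "'m set \<Rightarrow> bool" where
  "noint S \<longleftrightarrow> (\<forall>a b. a < b \<longrightarrow> \<not> {a<..<b} \<subseteq> S)"

lemma noint_right:
  assumes "dset S" "noint S" shows "\<exists>r>a. {a<..<r} \<inter> S = {}"
proof -
  obtain r where "r > a" "{a<..<r} \<subseteq> S \<or> {a<..<r} \<inter> S = {}"
    using dset_right[OF assms(1), of a] by (elim exE conjE) (rule that)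
  then show ?thesis using assms(2)[unfolded noint_def, rule_format, of a r] by (intro exI[of _ r]) simp
qed

lemma noint_left:
  assumes "dset S" "noint S" shows "\<exists>r<a. {r<..<a} \<inter> S = {}"
proof -
  obtain r where "r < a" "{r<..<a} \<subseteq> S \<or> {r<..<a} \<inter> S = {}"
    using dset_left[OF assms(1), of a] by (elim exE conjE) (rule that)
  then show ?thesis using assms(2)[unfolded noint_def, rule_format, of r a] by (intro exI[of _ r]) simp
qed

lemma noint_isolated:
  assumes "dset S" "noint S" shows "\<exists>l r. l < a \<and> a < r \<and> S \<inter> {l<..<r} \<subseteq> {a}"
proof -
  obtain r where r: "r > a" "{a<..<r} \<inter> S = {}"
    using noint_right[OF assms, of a] by (elim exE conjE) (rule that)
  obtain l where l: "l < a" "{l<..<a} \<inter> S = {}"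
    using noint_left[OF assms, of a] by (elim exE conjE) (rule that)
  have "z = a" if "z \<in> S" "l < z" "z < r" for z
  proof (rule linorder_cases[of z a])
    assume "z < a" then have "z \<in> {l<..<a} \<inter> S" using that by simp
    then show ?thesis using l(2) by simp
  next
    assume "a < z" then have "z \<in> {a<..<r} \<inter> S" using that by simp
    then show ?thesis using r(2) by simp
  qed
  then show ?thesis using r(1) l(1) by (intro exI[of _ l] exI[of _ r]) auto
qed

text \<open>The infimum is attained, because the set misses some interval immediately to the right
  of it.\<close>

lemma noint_Min:
  assumes "dset S" "noint S" "S \<noteq> {}" "\<And>y. y \<in> S \<Longrightarrow> b \<le> y"
  shows "\<exists>s\<in>S. \<forall>y\<in>S. s \<le> y"
proof -
  obtain s where s: "\<forall>y\<in>S. s \<le> y" "\<forall>b. (\<forall>y\<in>S. b \<le> y) \<longrightarrow> b \<le> s"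
    using dset_Inf[OF assms(1,3,4)] by blast
  have "s \<in> S"
  proof (rule ccontr)
    assume "s \<notin> S"
    obtain r where r: "r > s" "{s<..<r} \<inter> S = {}" using noint_right[OF assms(1,2), of s] by (elim exE conjE) (rule that)
    have "\<forall>y\<in>S. r \<le> y"
      using r s(1) \<open>s \<notin> S\<close> by (metis disjoint_iff greaterThanLessThan_iff linorder_not_less order_le_imp_less_or_eq)
    then show False using s(2) r(1) by force
  qed
  then show ?thesis using s(1) by blast
qed

text \<open>If \<open>f\<close> were unbounded on every subinterval, then each set \<open>{f \<le> c}\<close> would be discrete, so the
  record minima of \<open>f\<close> to the right of a point would accumulate there, hence fill an
  interval, on which \<open>f\<close> would be decreasing.\<close>

lemma locally_bounded_above:
  assumes f: "tm (\<lambda>e. f (e 0))" and ab: "a < b"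
  shows "\<exists>t1 a' b'. a < t1 \<and> t1 < b \<and> a \<le> a' \<and> a' < b' \<and> b' \<le> b \<and> (\<forall>t. a' < t \<and> t < b' \<longrightarrow> f t \<le> f t1)"
proof (rule ccontr)
  assume "\<not> ?thesis"
  then have unb: "\<exists>t. a' < t \<and> t < b' \<and> \<not> f t \<le> f t1" if "a < t1" "t1 < b" "a \<le> a'" "a' < b'" "b' \<le> b" for t1 a' b'
    using that by blast
  obtain t0 where t0: "a < t0" "t0 < b" using dense_between[OF ab] by blast
  define N where "N = {t. t0 < t \<and> t < b \<and> (\<forall>t'. t0 < t' \<and> t' < t \<longrightarrow> f t < f t')}"
  have dN: "dset N"
    unfolding N_def dset_def mem_Collect_eq by (intro dfn_rules tm_app[OF f])
  have acc: "\<exists>m\<in>N. m < q" if q: "t0 < q" for q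
  proof -
    obtain t' where t': "t0 < t'" "t' < min q b" using dense_between[of t0 "min q b"] q t0 by auto
    define T where "T = {t. t0 < t \<and> t < min q b \<and> f t \<le> f t'}"
    have T: "dset T"
      unfolding T_def dset_def mem_Collect_eq min_less_iff_conj by (intro dfn_rules tm_app[OF f])
    have T0: "t' \<in> T" using t' by (auto simp: T_def)
    have "noint T"
      unfolding noint_def
    proof (intro allI impI notI)
      fix c d :: 'm assume cd: "c < d" "{c<..<d} \<subseteq> T"
      have "t0 \<le> c" "d \<le> b"
        using interval_subset[of c d t0 b] cd unfolding T_def by fastforce+
      then show False
        using unb[of t' c d] t' t0 cd unfolding T_def by force
    qed
    then have "\<exists>m\<in>T. \<forall>y\<in>T. m \<le> y"
      using T0 by (intro noint_Min[OF T, of t0]) (auto simp: T_def)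
    then obtain m where m: "m \<in> T" "\<forall>y\<in>T. m \<le> y" by blast
    have "f m < f z" if "t0 < z" "z < m" for z
    proof -
      have "z \<notin> T" using m(2) that by force
      then have "f t' < f z" using that m(1) by (auto simp: T_def)
      then show ?thesis using m(1) by (auto simp: T_def)
    qed
    then have "m \<in> N" using m(1) by (auto simp: N_def T_def)
    then show ?thesis using m(1) by (auto simp: T_def)
  qed
  obtain r where r: "r > t0" "{t0<..<r} \<subseteq> N \<or> {t0<..<r} \<inter> N = {}"
    using dset_right[OF dN, of t0] by (elim exE conjE) (rule that)
  have "{t0<..<r} \<subseteq> N"
  proof -
    obtain m where "m \<in> N" "m < r" using acc[OF r(1)] by blast
    then have "m \<in> {t0<..<r} \<inter> N" by (simp add: N_def)
    then show ?thesis using r(2) by blast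
  qed
  obtain t1 where t1: "t0 < t1" "t1 < r" using dense_between[OF r(1)] by blast
  have "t1 \<in> N" using t1 \<open>{t0<..<r} \<subseteq> N\<close> by auto
  then have "t1 < b" by (simp add: N_def)
  obtain t where t: "t1 < t" "t < min r b" "\<not> f t \<le> f t1"
    using unb[of t1 t1 "min r b"] less_trans[OF t0(1) t1(1)] less_imp_le[OF less_trans[OF t0(1) t1(1)]] t1 \<open>t1 < b\<close> by auto
  then have "t \<in> N" using t1 \<open>{t0<..<r} \<subseteq> N\<close> by auto
  then show False using t t1 by (auto simp: N_def)
qed

text \<open>That the bound is a value of \<open>f\<close> and not just a constant matters: if
  \<open>f\<close> is positive on the interval, so is the bound. Jumps and radii are made uniform in
  this way below.\<close>

lemma locally_bounded_below:
  assumes f: "tm (\<lambda>e. f (e 0))" and ab: "a < b"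
  shows "\<exists>t1 a' b'. a < t1 \<and> t1 < b \<and> a \<le> a' \<and> a' < b' \<and> b' \<le> b \<and> (\<forall>t. a' < t \<and> t < b' \<longrightarrow> f t1 \<le> f t)"
  using locally_bounded_above[of "\<lambda>t. - f t", OF tm_minus[OF f] ab] unfolding neg_le_iff .

section \<open>Definable choice\<close>

text \<open>Written with unbounded quantifiers over the line, so that after unfolding
  \<open>dfn_rules\<close> applies.\<close>

definition is_lub :: "'m set \<Rightarrow> 'm \<Rightarrow> bool" where
  "is_lub S s \<longleftrightarrow> (\<forall>y. y \<in> S \<longrightarrow> y \<le> s) \<and> (\<forall>b. (\<forall>y. y \<in> S \<longrightarrow> y \<le> b) \<longrightarrow> s \<le> b)"

definition is_glb :: "'m set \<Rightarrow> 'm \<Rightarrow> bool" where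
  "is_glb S s \<longleftrightarrow> (\<forall>y. y \<in> S \<longrightarrow> s \<le> y) \<and> (\<forall>b. (\<forall>y. y \<in> S \<longrightarrow> b \<le> y) \<longrightarrow> b \<le> s)"

lemma is_lub_unique: "is_lub S s \<Longrightarrow> is_lub S t \<Longrightarrow> s = t"
  unfolding is_lub_def by (meson order_antisym)

lemma is_glb_unique: "is_glb S s \<Longrightarrow> is_glb S t \<Longrightarrow> s = t"
  unfolding is_glb_def by (meson order_antisym)

lemma is_lub_exists:
  assumes "dset S" "x \<in> S" "\<And>y. y \<in> S \<Longrightarrow> y \<le> b" shows "\<exists>s. is_lub S s"
proof -
  have "S \<noteq> {}" using assms(2) by blast
  from dset_Sup[OF assms(1) this assms(3)] show ?thesis unfolding is_lub_def Ball_def by blast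
qed

lemma is_glb_exists:
  assumes "dset S" "x \<in> S" "\<And>y. y \<in> S \<Longrightarrow> b \<le> y" shows "\<exists>s. is_glb S s"
proof -
  have "S \<noteq> {}" using assms(2) by blast
  from dset_Inf[OF assms(1) this assms(3)] show ?thesis unfolding is_glb_def Ball_def by blast
qed

definition unit0 :: 'm where "unit0 = (SOME h. 0 < h)"

lemma unit0_pos: "0 < unit0"
  unfolding unit0_def using ex_greater by (rule someI_ex)

text \<open>Definable choice for a set meeting \<open>[0,\<infinity>)\<close>: its infimum there if attained; otherwise the set
  contains an interval \<open>(s, s + 2h)\<close> to the right of that infimum \<open>s\<close>, and we take \<open>s\<close> plus the
  supremum of such \<open>h\<close>, capped to keep it finite.\<close>

definition pickpos :: "'m set \<Rightarrow> 'm \<Rightarrow> bool" where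
  "pickpos S p \<longleftrightarrow> (\<exists>s. is_glb {x. x \<in> S \<and> 0 \<le> x} s \<and> (s \<in> S \<and> p = s \<or> s \<notin> S \<and>
     (\<exists>a. is_lub {h. 0 < h \<and> h \<le> unit0 \<and> (\<forall>x. s < x \<and> x < s + (h + h) \<longrightarrow> x \<in> S)} a \<and> p = s + a)))"

lemma pickpos_ex1:
  assumes S: "dset S" and ne: "\<exists>x. x \<in> S \<and> 0 \<le> x"
  shows "(\<exists>!p. pickpos S p) \<and> (\<forall>p. pickpos S p \<longrightarrow> p \<in> S)"
proof -
  define T where "T = {x. x \<in> S \<and> 0 \<le> x}"
  have T: "dset T" unfolding T_def dset_def mem_Collect_eq by (intro dfn_rules dfn_in[OF S])
  have "\<exists>s. is_glb T s"
    using ne by (elim exE, intro is_glb_exists[OF T, of _ 0]) (simp_all add: T_def)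
  then obtain s where s: "is_glb T s" by blast
  have s': "is_glb {x. x \<in> S \<and> 0 \<le> x} r \<longleftrightarrow> r = s" for r
    using s is_glb_unique unfolding T_def by blast
  show ?thesis
  proof (cases "s \<in> S")
    case True
    then have "pickpos S p \<longleftrightarrow> p = s" for p unfolding pickpos_def s' by blast
    then show ?thesis using True by simp
  next
    case False
    define A where "A = {h. 0 < h \<and> h \<le> unit0 \<and> (\<forall>x. s < x \<and> x < s + (h + h) \<longrightarrow> x \<in> S)}"
    have A: "dset A" unfolding A_def dset_def mem_Collect_eq by (intro dfn_rules dfn_in[OF S])
    obtain r where r: "r > s" "{s<..<r} \<subseteq> T \<or> {s<..<r} \<inter> T = {}"
      using dset_right[OF T, of s] by (elim exE conjE) (rule that)
    have rT: "{s<..<r} \<subseteq> T"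
    proof (rule ccontr)
      assume "\<not> ?thesis"
      then have "{s<..<r} \<inter> T = {}" using r(2) by simp
      then have "r \<le> y" if "y \<in> T" for y
      proof -
        have "s \<le> y" using s that unfolding is_glb_def by blast
        moreover have "s \<noteq> y" using False that unfolding T_def by blast
        moreover have "y \<notin> {s<..<r}" using \<open>{s<..<r} \<inter> T = {}\<close> that by blast
        ultimately show ?thesis by auto
      qed
      then have "r \<le> s" using s unfolding is_glb_def by blast
      then show False using r(1) by simp
    qed
    have "\<exists>h. h \<in> A"
    proof -
      have "0 < - s + r" using r(1) add_less_left_iff[of s 0 "- s + r"] by simp
      then have "0 < min (- s + r) unit0" using unit0_pos by simp
      then obtain h where h: "0 < h" "h + h < min (- s + r) unit0" using half_exists by blast
      have "h + h < unit0" using h(2) by simp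
      then have "h \<le> unit0" using less_imp_le[OF less_trans[OF less_add_pos[OF h(1), of h]]] by simp
      moreover have "s + (h + h) < r" using h(2) add_less_left_iff[of s "h + h" "- s + r"] by simp
      then have "x \<in> S" if "s < x" "x < s + (h + h)" for x
        using that less_trans[OF that(2)] subsetD[OF rT, of x] by (simp add: T_def)
      ultimately show ?thesis using h(1) unfolding A_def by blast
    qed
    then have "\<exists>a. is_lub A a"
      by (elim exE, intro is_lub_exists[OF A, of _ unit0]) (simp_all add: A_def)
    then obtain a where a: "is_lub A a" by blast
    have a': "is_lub {h. 0 < h \<and> h \<le> unit0 \<and> (\<forall>x. s < x \<and> x < s + (h + h) \<longrightarrow> x \<in> S)} b \<longleftrightarrow> b = a" for b
      unfolding A_def[symmetric] by (rule iffI, erule is_lub_unique[OF _ a], simp add: a)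
    have "pickpos S p \<longleftrightarrow> p = s + a" for p
      unfolding pickpos_def s' simp_thms a' using False by simp
    \<comment> \<open>The supremum \<open>a\<close> need not belong to \<open>A\<close>; the doubled
      length in \<open>A\<close> makes up for this. With \<open>b + b < a\<close>, some
      \<open>h\<close> in \<open>A\<close> exceeds \<open>a - b\<close>, hence also
      \<open>b\<close>. So \<open>a < h + h\<close>, and \<open>s + a\<close> lies in an interval
      contained in \<open>S\<close>.\<close>
    moreover have "s + a \<in> S"
    proof -
      obtain h0 where "h0 \<in> A" using \<open>\<exists>h. h \<in> A\<close> by blast
      then have "h0 \<le> a" using a unfolding is_lub_def by blast
      have "0 < h0" using \<open>h0 \<in> A\<close> by (simp add: A_def)
      then have "0 < a" using \<open>h0 \<le> a\<close> by (rule less_le_trans)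
      then obtain b where b: "0 < b" "b + b < a" using half_exists by blast
      have "a - b < a" using b(1) diff_pos_less by simp
      then obtain h where h: "h \<in> A" "a - b < h" using a unfolding is_lub_def
        by (meson linorder_not_less)
      have "b < a - b" using b(2) add_less_right_iff[of b b "a - b"] by simp
      then have "b < h" using h(2) by simp
      have "a = (a - b) + b" by simp
      also have "\<dots> < (a - b) + h" using \<open>b < h\<close> by (simp only: add_less_left_iff)
      also have "\<dots> < h + h" using h(2) by (simp only: add_less_right_iff)
      finally have "s + a < s + (h + h)" by (simp only: add_less_left_iff)
      then show ?thesis using h(1) less_add_pos[OF \<open>0 < a\<close>, of s] by (simp add: A_def)
    qed
    ultimately show ?thesis by simp
  qed
qed

text \<open>A set without nonnegative elements is reflected first. The default 0 for the empty set
  makes the relation single-valued and total on definable sets, as \<open>tm_THE\<close> asks for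
  every environment.\<close>

definition pickrel :: "'m set \<Rightarrow> 'm \<Rightarrow> bool" where
  "pickrel S p \<longleftrightarrow> ((\<exists>x. x \<in> S \<and> 0 \<le> x) \<and> pickpos S p) \<or>
     (\<not> (\<exists>x. x \<in> S \<and> 0 \<le> x) \<and> (\<exists>x. x \<in> S) \<and> pickpos {x. - x \<in> S} (- p)) \<or>
     (\<not> (\<exists>x. x \<in> S) \<and> p = 0)"

definition pick :: "'m set \<Rightarrow> 'm" where
  "pick S = (THE p. pickrel S p)"

lemma pickrel_ex1:
  assumes S: "dset S"
  shows "(\<exists>!p. pickrel S p) \<and> (\<forall>p x. x \<in> S \<longrightarrow> pickrel S p \<longrightarrow> p \<in> S)"
proof (cases "\<exists>x. x \<in> S \<and> 0 \<le> x")
  case True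
  then have "pickrel S p \<longleftrightarrow> pickpos S p" for p unfolding pickrel_def by blast
  then show ?thesis using pickpos_ex1[OF S True] by simp
next
  case neg: False
  show ?thesis
  proof (cases "\<exists>x. x \<in> S")
    case True
    have dneg: "dset {x. - x \<in> S}" unfolding dset_def mem_Collect_eq by (intro dfn_rules dfn_in[OF S])
    obtain x where x: "x \<in> S" "x < 0" using True neg by (meson not_le)
    have "0 \<le> - x" using x(2) neg_le_iff[of 0 x] by simp
    then have "\<exists>x. x \<in> {x. - x \<in> S} \<and> 0 \<le> x" using x(1) by (intro exI[of _ "- x"]) simp
    note p = pickpos_ex1[OF dneg this]
    have eq: "pickrel S p \<longleftrightarrow> pickpos {x. - x \<in> S} (- p)" for p
      using True neg unfolding pickrel_def by blast
    obtain p where p1: "pickpos {x. - x \<in> S} p" "\<And>q. pickpos {x. - x \<in> S} q \<Longrightarrow> q = p" using p by blast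
    have "\<exists>!q. pickpos {x. - x \<in> S} (- q)"
    proof (rule ex1I[of _ "- p"])
      show "pickpos {x. - x \<in> S} (- (- p))" using p1(1) by simp
      show "q = - p" if "pickpos {x. - x \<in> S} (- q)" for q using p1(2)[OF that] by (metis minus_minus)
    qed
    moreover have "q \<in> S" if "pickpos {x. - x \<in> S} (- q)" for q
      using p that by force
    ultimately show ?thesis unfolding eq by blast
  next
    case False
    then have "pickrel S p \<longleftrightarrow> p = 0" for p unfolding pickrel_def by blast
    then show ?thesis using False by simp
  qed
qed

lemma pick_in: "dset S \<Longrightarrow> x \<in> S \<Longrightarrow> pick S \<in> S"
  unfolding pick_def using pickrel_ex1[of S] theI'[of "pickrel S"] by blast

text \<open>The chosen element depends on the set alone and has a first-order description, so the
  choice is uniform in the parameters.\<close>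

lemma tm_pick:
  assumes H: "dfn (\<lambda>e. P (e 0) (\<lambda>i. e (Suc i)))"
  shows "tm (\<lambda>e. pick {a. P a e})"
  unfolding pick_def
proof (rule tm_THE)
  show "\<exists>!p. pickrel {a. P a e} p" for e
    using pickrel_ex1[OF dset_fibre[OF H]] by blast
  show "dfn (\<lambda>e. pickrel {a. P a (\<lambda>i. e (Suc i))} (e 0))"
    unfolding pickrel_def pickpos_def is_lub_def is_glb_def mem_Collect_eq
    by (intro dfn_rules dfn_inst1[OF H])
qed

primrec pickl :: "nat \<Rightarrow> 'm list set \<Rightarrow> 'm list" where
  "pickl 0 S = []"
| "pickl (Suc l) S = (let a = pick {a. \<exists>y. length y = l \<and> a # y \<in> S} in a # pickl l {y. a # y \<in> S})"

lemma tml_pickl: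
  assumes "dfn (\<lambda>e. P (map e [0..<l]) (\<lambda>i. e (i + l)))"
  shows "tml l (\<lambda>e. pickl l {y. P y e})"
  using assms
proof (induction l arbitrary: P)
  case 0
  then show ?case by (simp add: tml_Nil)
next
  case (Suc l)
  define a where "a e = pick {a. \<exists>y. length y = l \<and> P (a # y) e}" for e
  have a: "tm a"
    unfolding a_def
    by (rule tm_pick, rule dfn_exl, rule dfn_instl[OF Suc.prems], intro tml_Cons tm_var tml_vars)
  have "tml l (\<lambda>e. pickl l {y. P (a e # y) e})"
    by (rule Suc.IH, rule dfn_instl[OF Suc.prems], intro tml_Cons tm_rename[OF a] tml_vars)
  then have "tml (Suc l) (\<lambda>e. a e # pickl l {y. P (a e # y) e})" using a by (intro tml_Cons)
  then show ?case by (simp add: a_def Let_def)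
qed

lemma pickl_in:
  assumes "dfn (\<lambda>e. P (map e [0..<l]) (\<lambda>i. e (i + l)))" "length y = l" "P y e"
  shows "P (pickl l {y. P y e}) e"
  using assms
proof (induction l arbitrary: P y)
  case 0
  then show ?case by simp
next
  case (Suc l)
  define A where "A = {a. \<exists>y. length y = l \<and> P (a # y) e}"
  have "dset A"
    unfolding A_def
    by (rule dset_fibre, rule dfn_exl, rule dfn_instl[OF Suc.prems(1)], intro tml_Cons tm_var tml_vars)
  moreover have "hd y \<in> A" using Suc.prems(2,3) by (auto simp: A_def length_Suc_conv)
  ultimately have "pick A \<in> A" by (rule pick_in)
  then obtain y' where y': "length y' = l" "P (pick A # y') e" by (auto simp: A_def)
  have "P (pick A # pickl l {y. P (pick A # y) e}) e"
    by (rule Suc.IH[where P = "\<lambda>y e. P (pick A # y) e", OF _ y'], rule dfn_instl[OF Suc.prems(1)],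
        intro tml_Cons tm_const tml_vars)
  then show ?case by (simp add: A_def Let_def)
qed

section \<open>Points of continuity, and families of sets without interior\<close>

definition contat :: "('m \<Rightarrow> 'm) \<Rightarrow> 'm \<Rightarrow> bool" where
  "contat f p \<longleftrightarrow> (\<forall>d>0. \<exists>l r. l < p \<and> p < r \<and> (\<forall>q. l < q \<and> q < r \<longrightarrow> f q < f p + d \<and> f p < f q + d))"

text \<open>A discontinuity of size \<open>\<ge> c > 0\<close> at all points of an interval contradicts the existence of
  one-sided limits, which local o-minimality provides.\<close>

lemma contat_exists:
  assumes f: "tm (\<lambda>e. f (e 0))" and ab: "a < b"
  shows "\<exists>p. a < p \<and> p < b \<and> contat f p"
proof (rule ccontr)
  assume disc: "\<not> ?thesis"
  obtain u1 a1 b1 where 1: "a \<le> a1" "a1 < b1" "b1 \<le> b" "\<forall>t. a1 < t \<and> t < b1 \<longrightarrow> f t \<le> f u1"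
    using locally_bounded_above[OF f ab] by blast
  obtain u2 a2 b2 where 2: "a1 \<le> a2" "a2 < b2" "b2 \<le> b1" "\<forall>t. a2 < t \<and> t < b2 \<longrightarrow> f u2 \<le> f t"
    using locally_bounded_below[OF f 1(2)] by blast
  \<comment> \<open>\<open>dd t\<close> is a definably chosen size of the discontinuity at
    \<open>t\<close>. Bounding it from below on a subinterval by one of its own values gives the
    uniform \<open>c > 0\<close>; the bounds on \<open>f\<close> obtained before make the one-sided
    limit finite.\<close>
  define dd where "dd t = pick {d. 0 < d \<and> (\<forall>l r. l < t \<and> t < r \<longrightarrow>
      (\<exists>q. l < q \<and> q < r \<and> \<not> (f q < f t + d \<and> f t < f q + d)))}" for t
  have dd_tm: "tm (\<lambda>e. dd (e 0))"
    unfolding dd_def by (rule tm_pick) (intro dfn_rules tm_app[OF f])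
  have dd: "0 < dd t \<and> (\<forall>l r. l < t \<and> t < r \<longrightarrow>
      (\<exists>q. l < q \<and> q < r \<and> \<not> (f q < f t + dd t \<and> f t < f q + dd t)))" if "a < t" "t < b" for t
  proof -
    let ?S = "{d. 0 < d \<and> (\<forall>l r. l < t \<and> t < r \<longrightarrow> (\<exists>q. l < q \<and> q < r \<and> \<not> (f q < f t + d \<and> f t < f q + d)))}"
    have "\<not> contat f t" using disc that by blast
    then obtain d where "0 < d" "\<And>l r. l < t \<Longrightarrow> t < r \<Longrightarrow> \<exists>q. l < q \<and> q < r \<and> \<not> (f q < f t + d \<and> f t < f q + d)"
      unfolding contat_def by blast
    then have "d \<in> ?S" by blast
    moreover have "dset ?S"
      unfolding dset_def mem_Collect_eq by (intro dfn_rules tm_app[OF f])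
    ultimately have "pick ?S \<in> ?S" by (intro pick_in)
    then show ?thesis unfolding dd_def by blast
  qed
  obtain u3 a3 b3 where 3: "a2 < u3" "u3 < b2" "a2 \<le> a3" "a3 < b3" "b3 \<le> b2" "\<forall>t. a3 < t \<and> t < b3 \<longrightarrow> dd u3 \<le> dd t"
    using locally_bounded_below[OF dd_tm 2(2)] by blast
  define c where "c = dd u3"
  have in_ab: "a < t \<and> t < b" if "a2 < t" "t < b2" for t
    using that 1 2 by (meson le_less_trans less_le_trans)
  have c: "0 < c" using dd[of u3] in_ab[OF 3(1,2)] by (simp add: c_def)
  have osc: "\<exists>q. l < q \<and> q < r \<and> \<not> (f q < f t + c \<and> f t < f q + c)"
    if tt: "a3 < t" "t < b3" "l < t" "t < r" for t l r
  proof -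
    have t: "a2 < t" "t < b2" using tt 3(3,5) by (meson le_less_trans less_le_trans)+
    obtain q where q: "l < q" "q < r" "\<not> (f q < f t + dd t \<and> f t < f q + dd t)"
      using dd[of t] in_ab[OF t] tt(3,4) by blast
    have "c \<le> dd t" using 3(6) tt by (simp add: c_def)
    then have "f t + c \<le> f t + dd t" "f q + c \<le> f q + dd t" by (simp_all add: add_le_left_iff)
    then have "\<not> (f q < f t + c \<and> f t < f q + c)" using q(3) by (meson less_le_trans)
    then show ?thesis using q by blast
  qed
  obtain t0 where t0: "a3 < t0" "t0 < b3" using dense_between[OF 3(4)] by blast
  have t2: "a2 < t \<and> t < b2" if "t0 < t" "t < b3" for t
    using that t0 3(3,5) by (meson le_less_trans less_le_trans less_trans)
  have lo: "f u2 \<le> f t" if "t0 < t" "t < b3" for t using t2[OF that] 2(4) by blast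
  have up: "f t \<le> f u1" if "t0 < t" "t < b3" for t
    using t2[OF that] 1(4) 2(1,3) by (meson le_less_trans less_le_trans)
  \<comment> \<open>The supremum \<open>L\<close> of \<open>V\<close> is the lower limit of
    \<open>f\<close> at \<open>t0\<close> from the right. Any \<open>r\<close> above
    \<open>L\<close> eventually exceeds \<open>f\<close>: otherwise \<open>dset_right\<close> would
    give \<open>r \<le> f t\<close> near \<open>t0\<close>, putting \<open>r\<close> into
    \<open>V\<close>. So near \<open>t0\<close> the values of \<open>f\<close> are within
    \<open>c\<close> of each other, against \<open>osc\<close>.\<close>
  define V where "V = {v. \<exists>r. t0 < r \<and> (\<forall>t. t0 < t \<and> t < r \<longrightarrow> v \<le> f t)}"
  have dV: "dset V" unfolding V_def dset_def mem_Collect_eq by (intro dfn_rules tm_app[OF f])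
  have V0: "f u2 \<in> V" using lo t0(2) unfolding V_def by blast
  have Vb: "v \<le> f u1" if v: "v \<in> V" for v
  proof -
    obtain r where r: "t0 < r" "\<forall>t. t0 < t \<and> t < r \<longrightarrow> v \<le> f t" using v unfolding V_def by blast
    obtain t where "t0 < t" "t < min r b3" using dense_between[of t0 "min r b3"] r(1) t0(2) by auto
    then show ?thesis using r(2) up[of t] by (auto intro: order_trans)
  qed
  obtain L where L: "\<forall>y\<in>V. y \<le> L" "\<forall>b. (\<forall>y\<in>V. y \<le> b) \<longrightarrow> L \<le> b"
    using dset_Sup[OF dV _ Vb] V0 by blast
  obtain l r where lr: "l < L" "L < r" "\<forall>a b. a \<le> r \<longrightarrow> l \<le> b \<longrightarrow> a < b + c"
    using small_nbhd[OF c, of L] by blast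
  obtain v where v: "v \<in> V" "l < v" using L(2) lr(1) by (meson not_le)
  then obtain r1 where r1: "t0 < r1" "\<forall>t. t0 < t \<and> t < r1 \<longrightarrow> v \<le> f t" unfolding V_def by blast
  have dr: "dset {t. f t < r}" unfolding dset_def mem_Collect_eq by (intro dfn_rules tm_app[OF f])
  obtain r2 where r2: "t0 < r2" "{t0<..<r2} \<subseteq> {t. f t < r} \<or> {t0<..<r2} \<inter> {t. f t < r} = {}"
    using dset_right[OF dr, of t0] by (elim exE conjE) (rule that)
  have r2': "f t < r" if "t0 < t" "t < r2" for t
  proof (rule ccontr)
    assume n: "\<not> f t < r"
    have "t \<in> {t0<..<r2}" using that by simp
    then have "{t0<..<r2} \<inter> {t. f t < r} = {}" using r2(2) n by blast
    then have "r \<le> f t'" if "t0 < t'" "t' < r2" for t' using that by fastforce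
    then have "r \<in> V" using r2(1) unfolding V_def by blast
    then show False using L(1) lr(2) by (meson not_le)
  qed
  define r3 where "r3 = min r1 (min r2 b3)"
  have "t0 < r3" using r1(1) r2(1) t0(2) by (simp add: r3_def)
  then obtain t where t: "t0 < t" "t < r3" using dense_between by blast
  have near: "l \<le> f q \<and> f q \<le> r" if "t0 < q" "q < r3" for q
  proof -
    have "l < f q" using r1(2) v(2) that by (auto simp: r3_def intro: less_le_trans)
    moreover have "f q < r" using r2' that by (simp add: r3_def)
    ultimately show ?thesis by (simp add: less_imp_le)
  qed
  have "a3 < t" "t < b3" using t t0(1) by (auto simp: r3_def intro: less_trans)
  then obtain q where q: "t0 < q" "q < r3" "\<not> (f q < f t + c \<and> f t < f q + c)"
    using osc[of t t0 r3] t by blast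
  then show False using near[OF q(1,2)] near[OF t] lr(3) by blast
qed

text \<open>If the union contained an interval, choose an index \<open>g p\<close> in
  \<open>A\<close> for each of its points. At a point where \<open>g\<close> is continuous,
  discreteness of \<open>A\<close> makes \<open>g\<close> locally constant, so a single member would
  contain an interval.\<close>

lemma noint_UN:
  assumes D: "dfn (\<lambda>e. D (e 0) (e (Suc 0)))" and A: "dset A" "noint A"
    and noint: "\<And>a. a \<in> A \<Longrightarrow> noint {p. D a p}"
  shows "noint {p. \<exists>a. a \<in> A \<and> D a p}"
  unfolding noint_def
proof (intro allI impI notI)
  fix c d :: 'm assume cd: "c < d" "{c<..<d} \<subseteq> {p. \<exists>a. a \<in> A \<and> D a p}"
  define g where "g p = pick {a. a \<in> A \<and> D a p}" for p
  have g: "tm (\<lambda>e. g (e 0))"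
    unfolding g_def by (rule tm_pick) (intro dfn_rules dfn_in[OF A(1)] dfn_inst_11[OF D])
  have gin: "g p \<in> A \<and> D (g p) p" if "c < p" "p < d" for p
  proof -
    have "p \<in> {p. \<exists>a. a \<in> A \<and> D a p}" using subsetD[OF cd(2), of p] that by simp
    then obtain a where "a \<in> {a. a \<in> A \<and> D a p}" by blast
    moreover have "dset {a. a \<in> A \<and> D a p}"
      unfolding dset_def mem_Collect_eq by (intro dfn_rules dfn_in[OF A(1)] dfn_inst_11[OF D])
    ultimately have "pick {a. a \<in> A \<and> D a p} \<in> {a. a \<in> A \<and> D a p}" by (intro pick_in)
    then show ?thesis unfolding g_def by blast
  qed
  obtain p where p: "c < p" "p < d" "contat g p" using contat_exists[OF g cd(1)] by blast
  obtain l r where lr: "l < g p" "g p < r" "A \<inter> {l<..<r} \<subseteq> {g p}"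
    using noint_isolated[OF A, of "g p"] by (elim exE conjE) (rule that)
  obtain d1 where d1: "0 < d1" "g p + d1 \<le> r" using pos_gap[OF lr(2)] .
  obtain d2 where d2: "0 < d2" "l + d2 \<le> g p" using pos_gap[OF lr(1)] .
  obtain h where h: "0 < h" "g p + h \<le> r" "l + h \<le> g p" using pos_min[OF d1(1) d2(1) d1(2) d2(2)] by blast
  obtain l' r' where lr': "l' < p" "p < r'" "\<forall>q. l' < q \<and> q < r' \<longrightarrow> g q < g p + h \<and> g p < g q + h"
    using p(3) h(1) unfolding contat_def by blast
  have const: "D (g p) q" if q: "l' < q" "q < r'" "c < q" "q < d" for q
  proof -
    have "g q < r" using lr'(3) q h(2) by (meson less_le_trans)
    have "l + h < g q + h" using lr'(3) q h(3) by (meson le_less_trans)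
    then have "l < g q" by (simp add: add_less_right_iff)
    then have "g q \<in> A \<inter> {l<..<r}" using gin[OF q(3,4)] \<open>g q < r\<close> by simp
    then have "g q = g p" using lr(3) by blast
    then show ?thesis using gin[OF q(3,4)] by simp
  qed
  have "{max l' c<..<min r' d} \<subseteq> {q. D (g p) q}" using const by auto
  moreover have "max l' c < min r' d" using lr' p cd(1) by (auto intro: less_trans)
  ultimately show False using noint[of "g p"] gin[OF p(1,2)] unfolding noint_def by blast
qed

text \<open>A family of subsets of the line without interior, indexed by \<open>l\<close>-tuples, does not catch all
  finite subsets of an interval. Induction on \<open>l\<close>: if \<open>q\<close> lies in the member with index \<open>z1 # z\<close>, then
  either \<open>z1\<close> is interior to the set of all such \<open>z1\<close> (for fixed \<open>z\<close> this happens for few \<open>q\<close>), or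
  \<open>z1\<close> ranges over a set without interior determined by \<open>q\<close> and \<open>z\<close>.\<close>

lemma no_finite_cover:
  assumes "dfn (\<lambda>e. D (e 0) (map (\<lambda>i. e (Suc i)) [0..<l]))"
    and "\<And>z. length z = l \<Longrightarrow> noint {q. D q z}" and "a < b"
  shows "\<exists>F. finite F \<and> F \<subseteq> {a<..<b} \<and> \<not> (\<exists>z. length z = l \<and> (\<forall>q\<in>F. D q z))"
  using assms(1,2)
proof (induction l arbitrary: D)
  case 0
  have "\<not> {a<..<b} \<subseteq> {q. D q []}" using 0(2)[of "[]"] assms(3) unfolding noint_def by simp
  then obtain q where "q \<in> {a<..<b}" "\<not> D q []" by blast
  then show ?case by (intro exI[of _ "{q}"]) simp
next
  case (Suc l)
  note DI = dfn_inst_1l[OF Suc.prems(1)]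
  define near :: "'m \<Rightarrow> 'm \<Rightarrow> 'm \<Rightarrow> bool" where "near m d x \<longleftrightarrow> x < m + d \<and> m < x + d" for m d x
  define D1 where "D1 q z \<longleftrightarrow> (\<exists>m d. 0 < d \<and> (\<forall>x. near m d x \<longrightarrow> D q (x # z)))" for q z
  define R where "R q z1 z \<longleftrightarrow> D q (z1 # z) \<and> \<not> (\<exists>d. 0 < d \<and> (\<forall>x. near z1 d x \<longrightarrow> D q (x # z)))" for q z1 z
  have dD1: "dfn (\<lambda>e. D1 (e 0) (map (\<lambda>i. e (Suc i)) [0..<l]))"
    unfolding D1_def near_def by (intro dfn_rules DI tml_Cons tml_vars)
  have noD1: "noint {q. D1 q z}" if z: "length z = l" for z
    unfolding noint_def
  proof (intro allI impI notI)
    fix c d :: 'm assume cd: "c < d" "{c<..<d} \<subseteq> {q. D1 q z}"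
    \<comment> \<open>\<open>M q\<close> and \<open>H q\<close> are centre and radius of an interval
      of admissible first index coordinates. Where \<open>H\<close> is bounded below and
      \<open>M\<close> is continuous, the one value \<open>M p\<close> is admissible for all nearby
      \<open>q\<close>, so the member with index \<open>M p # z\<close> would contain an
      interval.\<close>
    define M where "M q = pick {m. \<exists>d. 0 < d \<and> (\<forall>x. near m d x \<longrightarrow> D q (x # z))}" for q
    define H where "H q = pick {d. 0 < d \<and> (\<forall>x. near (M q) d x \<longrightarrow> D q (x # z))}" for q
    have M: "tm (\<lambda>e. M (e 0))"
      unfolding M_def near_def by (rule tm_pick) (intro dfn_rules DI tml_Cons tml_const z)
    have H: "tm (\<lambda>e. H (e 0))"
      unfolding H_def near_def by (rule tm_pick) (intro dfn_rules DI tml_Cons tml_const z tm_app[OF M])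
    have HM: "0 < H q \<and> (\<forall>x. near (M q) (H q) x \<longrightarrow> D q (x # z))" if q: "c < q" "q < d" for q
    proof -
      let ?S = "{m. \<exists>d. 0 < d \<and> (\<forall>x. near m d x \<longrightarrow> D q (x # z))}"
      have "D1 q z" using cd(2) q by auto
      then obtain m where "m \<in> ?S" unfolding D1_def by blast
      moreover have "dset ?S"
        unfolding dset_def mem_Collect_eq near_def by (intro dfn_rules DI tml_Cons tml_const z)
      ultimately have "pick ?S \<in> ?S" by (intro pick_in)
      then have "M q \<in> ?S" unfolding M_def .
      let ?T = "{d. 0 < d \<and> (\<forall>x. near (M q) d x \<longrightarrow> D q (x # z))}"
      obtain d where "d \<in> ?T" using \<open>M q \<in> ?S\<close> by blast
      moreover have "dset ?T"
        unfolding dset_def mem_Collect_eq near_def by (intro dfn_rules DI tml_Cons tml_const z)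
      ultimately have "pick ?T \<in> ?T" by (intro pick_in)
      then show ?thesis unfolding H_def by blast
    qed
    obtain u c' d' where u: "c < u" "u < d" "c \<le> c'" "c' < d'" "d' \<le> d" "\<forall>t. c' < t \<and> t < d' \<longrightarrow> H u \<le> H t"
      using locally_bounded_below[OF H cd(1)] by blast
    have Hu: "0 < H u" using HM[OF u(1,2)] by blast
    obtain p where p: "c' < p" "p < d'" "contat M p" using contat_exists[OF M u(4)] by blast
    obtain l' r' where lr: "l' < p" "p < r'" "\<forall>q. l' < q \<and> q < r' \<longrightarrow> M q < M p + H u \<and> M p < M q + H u"
      using p(3) Hu unfolding contat_def by blast
    have "D q (M p # z)" if q: "l' < q" "q < r'" "c' < q" "q < d'" for q
    proof -
      have "c < q" "q < d" using q u(3,5) by (meson le_less_trans less_le_trans)+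
      have "H u \<le> H q" using u(6) q by blast
      then have "M p + H u \<le> M p + H q" "M q + H u \<le> M q + H q" by (simp_all add: add_le_left_iff)
      then have "near (M q) (H q) (M p)"
        unfolding near_def using lr(3) q by (meson less_le_trans)
      then show ?thesis using HM[OF \<open>c < q\<close> \<open>q < d\<close>] by blast
    qed
    then have "{max l' c'<..<min r' d'} \<subseteq> {q. D q (M p # z)}" by auto
    moreover have "max l' c' < min r' d'" using lr p u(4) by (auto intro: less_trans)
    ultimately show False using Suc.prems(2)[of "M p # z"] z unfolding noint_def by auto
  qed
  obtain F1 where F1: "finite F1" "F1 \<subseteq> {a<..<b}" "\<not> (\<exists>z. length z = l \<and> (\<forall>q\<in>F1. D1 q z))"
    using Suc.IH[OF dD1 noD1] by blast
  have "\<exists>F. finite F \<and> F \<subseteq> {a<..<b} \<and> \<not> (\<exists>z. length z = l \<and> (\<forall>p\<in>F. \<exists>z1. R q z1 z \<and> D p (z1 # z)))" for q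
  proof (rule Suc.IH[of "\<lambda>p z. \<exists>z1. R q z1 z \<and> D p (z1 # z)"])
    show "dfn (\<lambda>e. \<exists>z1. R q z1 (map (\<lambda>i. e (Suc i)) [0..<l]) \<and> D (e 0) (z1 # map (\<lambda>i. e (Suc i)) [0..<l]))"
      unfolding R_def near_def by (intro dfn_rules DI tml_Cons tml_vars)
    fix z :: "'m list" assume z: "length z = l"
    have "noint {p. \<exists>z1. z1 \<in> {z1. R q z1 z} \<and> D p (z1 # z)}"
    proof (rule noint_UN)
      show "dfn (\<lambda>e. D (e (Suc 0)) (e 0 # z))" by (intro DI tm_var tml_Cons tml_const z)
      show "dset {z1. R q z1 z}"
        unfolding dset_def mem_Collect_eq R_def near_def by (intro dfn_rules DI tml_Cons tml_const z)
      show "noint {p. D p (z1 # z)}" for z1 using Suc.prems(2)[of "z1 # z"] z by simp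
      show "noint {z1. R q z1 z}"
        unfolding noint_def
      proof (intro allI impI notI)
        fix c d :: 'm assume cd: "c < d" "{c<..<d} \<subseteq> {z1. R q z1 z}"
        obtain m where m: "c < m" "m < d" using dense_between[OF cd(1)] by blast
        obtain d1 where d1: "0 < d1" "m + d1 \<le> d" using pos_gap[OF m(2)] .
        obtain d2 where d2: "0 < d2" "c + d2 \<le> m" using pos_gap[OF m(1)] .
        obtain h where h: "0 < h" "m + h \<le> d" "c + h \<le> m" using pos_min[OF d1(1) d2(1) d1(2) d2(2)] by blast
        have "D q (x # z)" if x: "near m h x" for x
        proof -
          have "x < d" using x h(2) unfolding near_def by (meson less_le_trans)
          have "c + h < x + h" using x h(3) unfolding near_def by (meson le_less_trans)
          then have "c < x" by (simp add: add_less_right_iff)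
          then have "R q x z" using cd(2) \<open>x < d\<close> by auto
          then show ?thesis unfolding R_def by blast
        qed
        moreover have "R q m z" using cd(2) m by auto
        ultimately show False using h(1) unfolding R_def by blast
      qed
    qed
    then show "noint {p. \<exists>z1. R q z1 z \<and> D p (z1 # z)}" by simp
  qed
  \<comment> \<open>One finite set for each \<open>q\<close>: whichever \<open>q\<close> of
    \<open>F1\<close> escapes \<open>D1\<close> for a given \<open>z\<close>, its own
    \<open>F q\<close> rules out all first coordinates in \<open>R q\<close>. Only the finitely many
    \<open>q\<close> in \<open>F1\<close> matter.\<close>
  then obtain F where F: "\<And>q. finite (F q)" "\<And>q. F q \<subseteq> {a<..<b}"
    "\<And>q. \<not> (\<exists>z. length z = l \<and> (\<forall>p\<in>F q. \<exists>z1. R q z1 z \<and> D p (z1 # z)))" by metis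
  show ?case
  proof (intro exI conjI notI)
    show "finite (F1 \<union> (\<Union>q\<in>F1. F q))" using F1(1) F(1) by blast
    show "F1 \<union> (\<Union>q\<in>F1. F q) \<subseteq> {a<..<b}" using F1(2) F(2) by blast
    assume "\<exists>z. length z = Suc l \<and> (\<forall>q\<in>F1 \<union> (\<Union>q\<in>F1. F q). D q z)"
    then obtain z1 z where z: "length z = l" "\<And>q. q \<in> F1 \<union> (\<Union>q\<in>F1. F q) \<Longrightarrow> D q (z1 # z)"
      by (auto simp: length_Suc_conv)
    obtain q where q: "q \<in> F1" "\<not> D1 q z" using F1(3) z(1) by blast
    have "R q z1 z" using z(2)[of q] q unfolding R_def D1_def by blast
    then show False using F(3)[of q] z q(1) by blast
  qed
qed

text \<open>The point \<open>p\<close> is the supremum of all lower bounds of members, that is, the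
  limit of their infima along the family. Only this set of lower bounds has to be definable, so the
  index type is arbitrary; later, indices also carry intervals.\<close>

lemma filtered_accumulation:
  fixes F :: "'i \<Rightarrow> 'm set"
  assumes "dset {x. \<exists>z\<in>Z. \<forall>t\<in>F z. x \<le> t}" "Z \<noteq> {}"
    and ne: "\<And>z. z \<in> Z \<Longrightarrow> F z \<noteq> {}"
    and filt: "\<And>z z'. z \<in> Z \<Longrightarrow> z' \<in> Z \<Longrightarrow> \<exists>z''\<in>Z. F z'' \<subseteq> F z \<inter> F z'"
    and bdd: "\<And>z t. z \<in> Z \<Longrightarrow> t \<in> F z \<Longrightarrow> a \<le> t \<and> t \<le> b"
  shows "\<exists>p. \<forall>z\<in>Z. \<forall>l r. l < p \<and> p < r \<longrightarrow> (\<exists>t\<in>F z. l < t \<and> t < r)"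
proof -
  let ?S = "{x. \<exists>z\<in>Z. \<forall>t\<in>F z. x \<le> t}"
  have "a \<in> ?S" using assms(2) bdd by blast
  moreover have "x \<le> b" if x: "x \<in> ?S" for x
  proof -
    obtain z where z: "z \<in> Z" "\<forall>t\<in>F z. x \<le> t" using x by blast
    obtain t where "t \<in> F z" using ne[OF z(1)] by blast
    then show ?thesis using z(2) bdd[OF z(1)] order_trans by blast
  qed
  ultimately obtain p where p: "\<forall>y\<in>?S. y \<le> p" "\<forall>b. (\<forall>y\<in>?S. y \<le> b) \<longrightarrow> p \<le> b"
    using dset_Sup[OF assms(1), of b] by blast
  have "\<exists>t\<in>F z. l < t \<and> t < r" if z: "z \<in> Z" and lr: "l < p" "p < r" for z l r
  proof -
    obtain x where x: "x \<in> ?S" "l < x" using p(2) lr(1) by (meson not_le)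
    then obtain z0 where z0: "z0 \<in> Z" "\<forall>t\<in>F z0. x \<le> t" by blast
    obtain z' where z': "z' \<in> Z" "F z' \<subseteq> F z \<inter> F z0" using filt[OF z z0(1)] by blast
    have "r \<notin> ?S" using p(1) lr(2) by (meson not_le)
    then obtain t where t: "t \<in> F z'" "t < r" using z'(1) by (auto simp: not_le)
    then show ?thesis using z'(2) z0(2) x(2) by (meson IntE less_le_trans subsetD)
  qed
  then show ?thesis by blast
qed

end

section \<open>Exhausting a definable directed set\<close>

text \<open>\<open>D y z\<close> is to be read as \<open>z\<close> being an upper bound of
  \<open>y\<close>. Keeping \<open>Y\<close> and \<open>Z\<close> apart separates the elements to be
  bounded, whose coordinates are treated one by one, from the bounds.\<close>

locale directed_cover = dclo_group I for I :: "'r \<Rightarrow> 'm::{group_add,linorder} list \<Rightarrow> bool" +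
  fixes k l :: nat and Y Z :: "'m list set" and D :: "'m list \<Rightarrow> 'm list \<Rightarrow> bool"
  assumes definable_Y: "definable I k Y" and definable_Z: "definable I l Z"
    and dfn_D: "dfn (\<lambda>e. D (map e [0..<k]) (map (\<lambda>i. e (i + k)) [0..<l]))"
    and Z_nonempty: "Z \<noteq> {}"
    and directed: "\<And>z z'. z \<in> Z \<Longrightarrow> z' \<in> Z \<Longrightarrow> \<exists>z''\<in>Z. \<forall>y. D y z \<or> D y z' \<longrightarrow> D y z''"
    and covers: "\<And>y. y \<in> Y \<Longrightarrow> \<exists>z\<in>Z. D y z"
begin

text \<open>The statement for an induction that lowers \<open>m\<close>: a common bound is demanded
  only for tuples with the same first \<open>m\<close> coordinates. For \<open>m = k\<close> it
  concerns single tuples, and \<open>m = 0\<close> is the goal.\<close>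

definition exhaust :: "nat \<Rightarrow> ('m list \<Rightarrow> 'm \<Rightarrow> 'm \<Rightarrow> bool) \<Rightarrow> bool" where
  "exhaust m K \<longleftrightarrow>
     dfn (\<lambda>e. K (map (\<lambda>i. e (Suc (Suc i))) [0..<k]) (e 0) (e (Suc 0))) \<and>
     (\<forall>y s u s' u'. K y s u \<longrightarrow> 0 < s' \<longrightarrow> s' \<le> s \<longrightarrow> u \<le> u' \<longrightarrow> K y s' u') \<and>
     (\<forall>y\<in>Y. \<exists>s u. 0 < s \<and> 0 < u \<and> K y s u) \<and>
     (\<forall>c s u. 0 < s \<longrightarrow> 0 < u \<longrightarrow> (\<exists>z\<in>Z. \<forall>y. length y = k \<longrightarrow> take m y = c \<longrightarrow> K y s u \<longrightarrow> D y z))"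

lemma exhaustD:
  assumes "exhaust m K"
  shows "dfn (\<lambda>e. K (map (\<lambda>i. e (Suc (Suc i))) [0..<k]) (e 0) (e (Suc 0)))"
    and "K y s u \<Longrightarrow> 0 < s' \<Longrightarrow> s' \<le> s \<Longrightarrow> u \<le> u' \<Longrightarrow> K y s' u'"
    and "y \<in> Y \<Longrightarrow> \<exists>s u. 0 < s \<and> 0 < u \<and> K y s u"
    and "0 < s \<Longrightarrow> 0 < u \<Longrightarrow> \<exists>z\<in>Z. \<forall>y. length y = k \<longrightarrow> take m y = c \<longrightarrow> K y s u \<longrightarrow> D y z"
  using assms unfolding exhaust_def by simp_all

lemma exhaust_top: "exhaust k (\<lambda>y s u. y \<in> Y)"
proof -
  have "\<exists>z\<in>Z. \<forall>y. length y = k \<longrightarrow> take k y = c \<longrightarrow> y \<in> Y \<longrightarrow> D y z" for c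
  proof (cases "c \<in> Y")
    case True
    then obtain z where "z \<in> Z" "D c z" using covers by blast
    then show ?thesis by (intro bexI[of _ z]) auto
  next
    case False
    then show ?thesis using Z_nonempty by auto
  qed
  moreover have "dfn (\<lambda>e. map (\<lambda>i. e (Suc (Suc i))) [0..<k] \<in> Y)"
    by (intro dfn_mem[OF definable_Y] tml_vars)
  ultimately show ?thesis using unit0_pos unfolding exhaust_def by blast
qed

lemma directed_finite:
  assumes "finite F" "\<And>q. q \<in> F \<Longrightarrow> \<exists>z\<in>Z. P q z"
    and "\<And>q z z'. P q z \<Longrightarrow> (\<forall>y. D y z \<longrightarrow> D y z') \<Longrightarrow> P q z'"
  shows "\<exists>z\<in>Z. \<forall>q\<in>F. P q z"
  using assms(1,2)
proof (induction F)
  case empty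
  then show ?case using Z_nonempty by auto
next
  case (insert q F)
  then obtain z1 z2 where z: "z1 \<in> Z" "\<forall>q\<in>F. P q z1" "z2 \<in> Z" "P q z2" by blast
  obtain z where z3: "z \<in> Z" "\<forall>y. D y z1 \<or> D y z2 \<longrightarrow> D y z" using directed[OF z(1,3)] by blast
  have "P q' z" if "q' \<in> insert q F" for q'
  proof (cases "q' = q")
    case True
    then show ?thesis using assms(3)[OF z(4)] z3(2) by blast
  next
    case False
    then have "P q' z1" using z(2) that by blast
    then show ?thesis using assms(3) z3(2) by blast
  qed
  then show ?case using z3(1) by blast
qed

end

section \<open>Releasing one coordinate\<close>

locale exhaust_step = directed_cover I k l Y Z D
  for I :: "'r \<Rightarrow> 'm::{group_add,linorder} list \<Rightarrow> bool" and k l Y Z D +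
  fixes m :: nat and K :: "'m list \<Rightarrow> 'm \<Rightarrow> 'm \<Rightarrow> bool"
  assumes m: "m < k" and K: "exhaust (Suc m) K"
begin

lemma K_dfn: "tml k v \<Longrightarrow> tm s \<Longrightarrow> tm u \<Longrightarrow> dfn (\<lambda>e. K (v e) (s e) (u e))"
  by (rule dfn_inst_l11[OF exhaustD(1)[OF K]])

lemma K_mono: "K y s u \<Longrightarrow> 0 < s' \<Longrightarrow> s' \<le> s \<Longrightarrow> u \<le> u' \<Longrightarrow> K y s' u'"
  by (rule exhaustD(2)[OF K])

text \<open>\<open>z\<close> bounds the fibre of the stage \<open>(s,u)\<close> of \<open>K\<close>
  over the prefix \<open>c\<close> and the next coordinate \<open>t\<close>. By hypothesis on
  \<open>K\<close> each single fibre has a bound; the task is to bound the fibres over all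
  \<open>t\<close> at once.\<close>

definition kap :: "'m list \<Rightarrow> 'm \<Rightarrow> 'm \<Rightarrow> 'm \<Rightarrow> 'm list \<Rightarrow> bool" where
  "kap c t s u z \<longleftrightarrow> (\<forall>y. length y = k \<longrightarrow> take m y = c \<and> y ! m = t \<and> K y s u \<longrightarrow> D y z)"

lemma kap_exists: "0 < s \<Longrightarrow> 0 < u \<Longrightarrow> \<exists>z\<in>Z. kap c t s u z"
proof -
  assume su: "0 < s" "0 < u"
  have *: "take (Suc m) y = take m y @ [y ! m]" if "length y = k" for y :: "'m list"
    using m that by (simp add: take_Suc_conv_app_nth)
  obtain z where z: "z \<in> Z" "\<forall>y. length y = k \<longrightarrow> take (Suc m) y = c @ [t] \<longrightarrow> K y s u \<longrightarrow> D y z"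
    using exhaustD(4)[OF K su, of "c @ [t]"] by blast
  then have "kap c t s u z" unfolding kap_def using * by simp
  then show ?thesis using z(1) by blast
qed

lemma kap_antimono: "kap c t s u z \<Longrightarrow> 0 < s \<Longrightarrow> s \<le> s' \<Longrightarrow> u' \<le> u \<Longrightarrow> kap c t s' u' z"
  unfolding kap_def using K_mono by blast

lemma kap_cover_mono: "kap c t s u z \<Longrightarrow> \<forall>y. D y z \<longrightarrow> D y z' \<Longrightarrow> kap c t s u z'"
  unfolding kap_def by blast

lemma kap_dfn:
  assumes "tml m c" "tm t" "tm s" "tm u" "tml l z"
  shows "dfn (\<lambda>e. kap (c e) (t e) (s e) (u e) (z e))"
  unfolding kap_def
  by (rule dfn_alll, intro dfn_rules, rule dfn_eql[where n = m])
    (use m in \<open>intro tml_take[where k = k] tm_nth[where k = k] K_dfn dfn_inst_ll[OF dfn_D] tml_vars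
       tml_rename[OF assms(1)] tm_rename[OF assms(2)] tm_rename[OF assms(3)] tm_rename[OF assms(4)]
       tml_rename[OF assms(5)] dfn_rules; simp\<close>)+

definition good :: "'m list \<Rightarrow> 'm \<Rightarrow> 'm \<Rightarrow> 'm \<Rightarrow> 'm \<Rightarrow> bool" where
  "good c t s u r \<longleftrightarrow> (\<exists>z\<in>Z. \<forall>t'. t' < t + r \<and> t < t' + r \<longrightarrow> kap c t' s u z)"

lemma good_mono:
  assumes "good c t s u r" "r' \<le> r" shows "good c t s u r'"
proof -
  have *: "a + r' \<le> a + r" for a using assms(2) by (simp add: add_le_left_iff)
  obtain z where z: "z \<in> Z" "\<forall>t'. t' < t + r \<and> t < t' + r \<longrightarrow> kap c t' s u z"
    using assms(1) unfolding good_def by blast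
  have "kap c t' s u z" if "t' < t + r'" "t < t' + r'" for t'
    using z(2) less_le_trans[OF that(1) *] less_le_trans[OF that(2) *] by blast
  then show ?thesis using z(1) unfolding good_def by blast
qed

lemma good_antimono: "good c t s u r \<Longrightarrow> 0 < s \<Longrightarrow> s \<le> s' \<Longrightarrow> u' \<le> u \<Longrightarrow> good c t s' u' r"
  unfolding good_def using kap_antimono by blast

lemma good_dfn:
  assumes "tml m c" "tm t" "tm s" "tm u" "tm r"
  shows "dfn (\<lambda>e. good (c e) (t e) (s e) (u e) (r e))"
  unfolding good_def
  by (rule dfn_bexl[OF definable_Z])
    (intro dfn_rules kap_dfn tml_vars
       tml_rename[OF assms(1)] tm_rename[OF assms(2)] tm_rename[OF assms(3)] tm_rename[OF assms(4)]
       tm_rename[OF assms(5)])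

text \<open>A single pair \<open>(s,u)\<close> without a radius makes \<open>t\<close> bad. At other
  values the radius may depend on the pair, which is why \<open>K1\<close> has to record
  one.\<close>

definition isbad :: "'m list \<Rightarrow> 'm \<Rightarrow> bool" where
  "isbad c t \<longleftrightarrow> (\<exists>s u. 0 < s \<and> 0 < u \<and> \<not> (\<exists>r. 0 < r \<and> good c t s u r))"

lemma isbad_dfn:
  assumes "tml m c" "tm t" shows "dfn (\<lambda>e. isbad (c e) (t e))"
  unfolding isbad_def by (intro dfn_rules good_dfn tml_rename[OF assms(1)] tm_rename[OF assms(2)])

lemma dset_isbad: "length c = m \<Longrightarrow> dset {t. isbad c t}"
  unfolding dset_def mem_Collect_eq by (intro isbad_dfn tml_const tm_var)

text \<open>On an interval of bad values a single pair can be made to fail everywhere on a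
  subinterval. There each \<open>z\<close> bounds fibres only over a set without interior, as
  otherwise some value would be good. But directedness yields one \<open>z\<close> for any finite
  set of values, contrary to \<open>no_finite_cover\<close>.\<close>

lemma noint_isbad:
  assumes c: "length c = m" shows "noint {t. isbad c t}"
  unfolding noint_def
proof (intro allI impI notI)
  fix a b :: 'm assume ab: "a < b" "{a<..<b} \<subseteq> {t. isbad c t}"
  define S where "S t = pick {s. \<exists>u. 0 < s \<and> 0 < u \<and> \<not> (\<exists>r. 0 < r \<and> good c t s u r)}" for t
  define U where "U t = pick {u. 0 < u \<and> \<not> (\<exists>r. 0 < r \<and> good c t (S t) u r)}" for t
  have S: "tm (\<lambda>e. S (e 0))"
    unfolding S_def by (rule tm_pick) (intro dfn_rules good_dfn tml_const c)
  have U: "tm (\<lambda>e. U (e 0))"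
    unfolding U_def by (rule tm_pick) (intro dfn_rules good_dfn tml_const c tm_app[OF S])
  have SU: "0 < S t \<and> 0 < U t \<and> \<not> (\<exists>r. 0 < r \<and> good c t (S t) (U t) r)" if t: "a < t" "t < b" for t
  proof -
    let ?S = "{s. \<exists>u. 0 < s \<and> 0 < u \<and> \<not> (\<exists>r. 0 < r \<and> good c t s u r)}"
    have "isbad c t" using subsetD[OF ab(2), of t] t by simp
    then obtain s where "s \<in> ?S" unfolding isbad_def by blast
    moreover have "dset ?S"
      unfolding dset_def mem_Collect_eq by (intro dfn_rules good_dfn tml_const c)
    ultimately have "pick ?S \<in> ?S" by (intro pick_in)
    then have St: "S t \<in> ?S" unfolding S_def .
    let ?U = "{u. 0 < u \<and> \<not> (\<exists>r. 0 < r \<and> good c t (S t) u r)}"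
    obtain u where "u \<in> ?U" using St by blast
    moreover have "dset ?U"
      unfolding dset_def mem_Collect_eq by (intro dfn_rules good_dfn tml_const c)
    ultimately have "pick ?U \<in> ?U" by (intro pick_in)
    then have "U t \<in> ?U" unfolding U_def .
    then show ?thesis using St by blast
  qed
  \<comment> \<open>Failure persists when \<open>s\<close> decreases and \<open>u\<close> increases,
    as the stage of \<open>K\<close> grows. So \<open>S\<close> is bounded from below and
    \<open>U\<close> from above.\<close>
  obtain v a1 b1 where 1: "a < v" "v < b" "a \<le> a1" "a1 < b1" "b1 \<le> b" "\<forall>t. a1 < t \<and> t < b1 \<longrightarrow> S v \<le> S t"
    using locally_bounded_below[OF S ab(1)] by blast
  obtain w a2 b2 where 2: "a1 < w" "w < b1" "a1 \<le> a2" "a2 < b2" "b2 \<le> b1" "\<forall>t. a2 < t \<and> t < b2 \<longrightarrow> U t \<le> U w"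
    using locally_bounded_above[OF U 1(4)] by blast
  have Sv: "0 < S v" using SU[OF 1(1,2)] by blast
  have Uw: "0 < U w" using SU[of w] 1 2(1,2) le_less_trans less_le_trans by blast
  have nogood: "\<not> good c t (S v) (U w) r" if t: "a2 < t" "t < b2" and r: "0 < r" for t r
  proof
    assume g: "good c t (S v) (U w) r"
    have t1: "a1 < t" "t < b1" using t 2(3,5) by (meson le_less_trans less_le_trans)+
    have t0: "a < t" "t < b" using t1 1(3,5) by (meson le_less_trans less_le_trans)+
    have "good c t (S t) (U t) r"
      using good_antimono[OF g Sv] 1(6) 2(6) t t1 by blast
    then show False using SU[OF t0] r by blast
  qed
  define E where "E q z \<longleftrightarrow> (a2 < q \<and> q < b2) \<and> z \<in> Z \<and> kap c q (S v) (U w) z" for q z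
  have E: "dfn (\<lambda>e. E (e 0) (map (\<lambda>i. e (Suc i)) [0..<l]))"
    unfolding E_def by (intro dfn_rules dfn_mem[OF definable_Z] kap_dfn tml_const c tml_vars)
  have "noint {q. E q z}" for z
    unfolding noint_def
  proof (intro allI impI notI)
    fix c1 d1 :: 'm assume cd: "c1 < d1" "{c1<..<d1} \<subseteq> {q. E q z}"
    obtain t where t: "c1 < t" "t < d1" using dense_between[OF cd(1)] by blast
    have Et: "E q z" if "c1 < q" "q < d1" for q using subsetD[OF cd(2), of q] that by simp
    obtain h1 where h1: "0 < h1" "t + h1 \<le> d1" using pos_gap[OF t(2)] .
    obtain h2 where h2: "0 < h2" "c1 + h2 \<le> t" using pos_gap[OF t(1)] .
    obtain h where h: "0 < h" "t + h \<le> d1" "c1 + h \<le> t" using pos_min[OF h1(1) h2(1) h1(2) h2(2)] by blast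
    have "kap c q (S v) (U w) z" if q: "q < t + h" "t < q + h" for q
    proof -
      have "q < d1" using q(1) h(2) by (rule less_le_trans)
      have "c1 + h < q + h" using h(3) q(2) by (rule le_less_trans)
      then have "c1 < q" by (simp add: add_less_right_iff)
      then show ?thesis using Et \<open>q < d1\<close> unfolding E_def by blast
    qed
    then have "good c t (S v) (U w) h" using Et[OF t] unfolding good_def E_def by blast
    then show False using nogood[of t h] Et[OF t] h(1) unfolding E_def by blast
  qed
  from no_finite_cover[OF E this 2(4)]
  obtain F where F: "finite F" "F \<subseteq> {a2<..<b2}" "\<not> (\<exists>z. length z = l \<and> (\<forall>q\<in>F. E q z))"
    by (elim exE conjE) (rule that)
  have "\<exists>z\<in>Z. \<forall>q\<in>F. kap c q (S v) (U w) z"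
    by (rule directed_finite[OF F(1)]) (use kap_exists[OF Sv Uw] kap_cover_mono in blast)+
  then obtain z where z: "z \<in> Z" "\<forall>q\<in>F. kap c q (S v) (U w) z" by blast
  have "length z = l" using z(1) definable_Z unfolding definable_def by blast
  moreover have "E q z" if "q \<in> F" for q using z subsetD[OF F(2) that] that unfolding E_def by simp
  ultimately show False using F(3) by blast
qed

text \<open>\<open>K1\<close> is meant for the good values of coordinate \<open>m\<close> and
  \<open>K2\<close> for the bad ones. The pair \<open>(s0,u0)\<close> at which \<open>t\<close> is
  good with radius \<open>s\<close> is confined to a closed box, while the tuple itself comes from a
  strictly earlier stage \<open>(s1,u1)\<close> of \<open>K\<close>.\<close>

definition K1 :: "'m list \<Rightarrow> 'm \<Rightarrow> 'm \<Rightarrow> bool" where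
  "K1 y s u \<longleftrightarrow> - u \<le> y ! m \<and> y ! m \<le> u \<and> (\<exists>s0 u0. s \<le> s0 \<and> s0 \<le> u \<and> s \<le> u0 \<and> u0 \<le> u \<and>
     good (take m y) (y ! m) s0 u0 s \<and> (\<exists>s1 u1. s0 + s \<le> s1 \<and> 0 < u1 \<and> u1 + s \<le> u0 \<and> K y s1 u1))"

definition K2 :: "'m list \<Rightarrow> 'm \<Rightarrow> 'm \<Rightarrow> bool" where
  "K2 y s u \<longleftrightarrow> isbad (take m y) (y ! m) \<and> - u \<le> y ! m \<and> y ! m \<le> u \<and> K y s u"

text \<open>Without a bound, the bad values of the tuples missed by \<open>z\<close> form a filtered
  family in \<open>[-u,u]\<close>, accumulating at some \<open>p\<close>. The bad values being
  discrete, \<open>p\<close> itself belongs to every member, but the fibre over \<open>p\<close>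
  does have a bound.\<close>

lemma K2_bounded:
  assumes c: "length c = m" and su: "0 < s" "0 < u"
  shows "\<exists>z\<in>Z. \<forall>y. length y = k \<longrightarrow> take m y = c \<longrightarrow> K2 y s u \<longrightarrow> D y z"
proof (rule ccontr)
  assume "\<not> ?thesis"
  then have bad: "\<exists>y. length y = k \<and> take m y = c \<and> K2 y s u \<and> \<not> D y z" if "z \<in> Z" for z
    using that by blast
  define F where "F z = {t. (isbad c t \<and> - u \<le> t \<and> t \<le> u) \<and>
      (\<exists>y. length y = k \<and> (take m y = c \<and> y ! m = t \<and> K y s u \<and> \<not> D y z))}" for z
  have "\<exists>p. \<forall>z\<in>Z. \<forall>l r. l < p \<and> p < r \<longrightarrow> (\<exists>t\<in>F z. l < t \<and> t < r)"
  proof (rule filtered_accumulation[where a = "- u" and b = u])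
    show "dset {x. \<exists>z\<in>Z. \<forall>t\<in>F z. x \<le> t}"
      unfolding dset_def mem_Collect_eq F_def Ball_def[of "Collect _"]
      by (rule dfn_bexl[OF definable_Z], rule dfn_all, rule dfn_imp, rule dfn_conj)
        (use m c in \<open>intro dfn_rules isbad_dfn dfn_exl dfn_eql[where n = m] tml_take[where k = k] tm_nth[where k = k]
          K_dfn dfn_inst_ll[OF dfn_D] tml_vars tml_const; simp\<close>)+
    show "Z \<noteq> {}" by (rule Z_nonempty)
    show "F z \<noteq> {}" if zZ: "z \<in> Z" for z
    proof -
      obtain y where y: "length y = k" "take m y = c" "K2 y s u" "\<not> D y z" using bad[OF zZ] by blast
      then have "y ! m \<in> F z" unfolding F_def K2_def by blast
      then show ?thesis by blast
    qed
    show "\<exists>z''\<in>Z. F z'' \<subseteq> F z \<inter> F z'" if zz: "z \<in> Z" "z' \<in> Z" for z z'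
    proof -
      obtain z'' where "z'' \<in> Z" "\<forall>y. D y z \<or> D y z' \<longrightarrow> D y z''" using directed[OF zz] by blast
      then show ?thesis unfolding F_def by (intro bexI[of _ z'']) blast+
    qed
  qed (simp add: F_def)
  then obtain p where p: "\<And>z l r. z \<in> Z \<Longrightarrow> l < p \<Longrightarrow> p < r \<Longrightarrow> \<exists>t\<in>F z. l < t \<and> t < r" by blast
  obtain l' r' where lr: "l' < p" "p < r'" "{t. isbad c t} \<inter> {l'<..<r'} \<subseteq> {p}"
    using noint_isolated[OF dset_isbad[OF c] noint_isbad[OF c], of p] by (elim exE conjE) (rule that)
  have pF: "p \<in> F z" if z: "z \<in> Z" for z
  proof -
    obtain t where t: "t \<in> F z" "l' < t" "t < r'" using p[OF z lr(1,2)] by blast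
    then have "t \<in> {t. isbad c t} \<inter> {l'<..<r'}" by (simp add: F_def)
    then show ?thesis using lr(3) t(1) by blast
  qed
  obtain z where "z \<in> Z" "kap c p s u z" using kap_exists[OF su] by blast
  then show False using pF[of z] unfolding F_def kap_def by blast
qed

text \<open>The margin \<open>s\<close> in \<open>K1\<close> makes the condition stable under small perturbations of
  \<open>(t, s0, u0)\<close>, so compactness of the box of these parameters applies.\<close>

lemma K1_bounded:
  assumes c: "length c = m" and su: "0 < s" "0 < u"
  shows "\<exists>z\<in>Z. \<forall>y. length y = k \<longrightarrow> take m y = c \<longrightarrow> K1 y s u \<longrightarrow> D y z"
proof (rule ccontr)
  assume "\<not> ?thesis"
  then have bad: "\<exists>y. length y = k \<and> take m y = c \<and> K1 y s u \<and> \<not> D y z" if "z \<in> Z" for z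
    using that by blast
  define F where "F z t s0 u0 \<longleftrightarrow> (- u \<le> t \<and> t \<le> u \<and> s \<le> s0 \<and> s0 \<le> u \<and> s \<le> u0 \<and> u0 \<le> u \<and> good c t s0 u0 s) \<and>
      (\<exists>y. length y = k \<and> (take m y = c \<and> y ! m = t \<and>
         (\<exists>s1 u1. s0 + s \<le> s1 \<and> 0 < u1 \<and> u1 + s \<le> u0 \<and> K y s1 u1) \<and> \<not> D y z))" for z t s0 u0
  have F_dfn: "dfn (\<lambda>e. F (map (\<lambda>i. e (\<sigma> i)) [0..<l]) (e i) (e i') (e i''))" for \<sigma> i i' i''
    unfolding F_def
    by (rule dfn_conj)
      (use m c in \<open>intro dfn_rules good_dfn dfn_exl dfn_eql[where n = m] tml_take[where k = k] tm_nth[where k = k]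
          K_dfn dfn_inst_ll[OF dfn_D] tml_vars tml_const; simp\<close>)+
  have F_ne: "\<exists>t s0 u0. F z t s0 u0" if "z \<in> Z" for z
  proof -
    obtain y where "length y = k" "take m y = c" "K1 y s u" "\<not> D y z" using bad[OF \<open>z \<in> Z\<close>] by blast
    then show ?thesis unfolding F_def K1_def by blast
  qed
  have F_filt: "\<exists>z''\<in>Z. \<forall>t s0 u0. F z'' t s0 u0 \<longrightarrow> F z t s0 u0 \<and> F z' t s0 u0" if zz: "z \<in> Z" "z' \<in> Z" for z z'
  proof -
    obtain z'' where "z'' \<in> Z" "\<forall>y. D y z \<or> D y z' \<longrightarrow> D y z''" using directed[OF zz] by blast
    then show ?thesis unfolding F_def by (intro bexI[of _ z'']) blast+
  qed
  have "\<exists>p. \<forall>z\<in>Z. \<forall>l r. l < p \<and> p < r \<longrightarrow> (\<exists>t\<in>{t. \<exists>s0 u0. F z t s0 u0}. l < t \<and> t < r)"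
  proof (rule filtered_accumulation[where a = "- u" and b = u])
    show "dset {x. \<exists>z\<in>Z. \<forall>t\<in>{t. \<exists>s0 u0. F z t s0 u0}. x \<le> t}"
      unfolding dset_def mem_Collect_eq Ball_def[of "Collect _"]
      by (rule dfn_bexl[OF definable_Z]) (intro dfn_rules F_dfn)
    show "\<exists>z''\<in>Z. {t. \<exists>s0 u0. F z'' t s0 u0} \<subseteq> {t. \<exists>s0 u0. F z t s0 u0} \<inter> {t. \<exists>s0 u0. F z' t s0 u0}"
      if "z \<in> Z" "z' \<in> Z" for z z' using F_filt[OF that] by blast
    show "- u \<le> t \<and> t \<le> u" if "t \<in> {t. \<exists>s0 u0. F z t s0 u0}" for z t using that unfolding F_def by blast
  qed (use Z_nonempty F_ne in auto)
  then obtain p1 where p1: "\<And>z l r. z \<in> Z \<Longrightarrow> l < p1 \<Longrightarrow> p1 < r \<Longrightarrow> \<exists>t s0 u0. F z t s0 u0 \<and> l < t \<and> t < r" by blast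
  \<comment> \<open>Compactness of the box is applied one coordinate at a time. Adding intervals
    around \<open>p1\<close> to the index makes \<open>p2\<close> an accumulation point of those
    \<open>s0\<close> whose \<open>t\<close> is close to \<open>p1\<close>; \<open>Z3\<close> does
    the same for \<open>u0\<close>.\<close>
  define Z2 where "Z2 = {(z, l, r). z \<in> Z \<and> l < p1 \<and> p1 < r}"
  define F2 where "F2 = (\<lambda>(z, l, r). {s0. \<exists>t u0. F z t s0 u0 \<and> l < t \<and> t < r})"
  have "\<exists>p. \<forall>z\<in>Z2. \<forall>l r. l < p \<and> p < r \<longrightarrow> (\<exists>t\<in>F2 z. l < t \<and> t < r)"
  proof (rule filtered_accumulation[where a = s and b = u])
    have "{x. \<exists>z\<in>Z2. \<forall>t\<in>F2 z. x \<le> t} = {x. \<exists>z\<in>Z. \<exists>l r. l < p1 \<and> p1 < r \<and>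
        (\<forall>s0. (\<exists>t u0. F z t s0 u0 \<and> l < t \<and> t < r) \<longrightarrow> x \<le> s0)}"
      unfolding Z2_def F2_def by auto
    moreover have "dset \<dots>"
      unfolding dset_def mem_Collect_eq by (rule dfn_bexl[OF definable_Z]) (intro dfn_rules F_dfn)
    ultimately show "dset {x. \<exists>z\<in>Z2. \<forall>t\<in>F2 z. x \<le> t}" by simp
    show "Z2 \<noteq> {}" using Z_nonempty ex_less[of p1] ex_greater[of p1] unfolding Z2_def by blast
    show "F2 z \<noteq> {}" if "z \<in> Z2" for z
      using that p1 unfolding Z2_def F2_def by fastforce
    show "\<exists>z''\<in>Z2. F2 z'' \<subseteq> F2 z \<inter> F2 z'" if zz: "z \<in> Z2" "z' \<in> Z2" for z z'
    proof -
      obtain w l r where z: "z = (w, l, r)" "w \<in> Z" "l < p1" "p1 < r" using zz(1) unfolding Z2_def by blast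
      obtain w' l' r' where z': "z' = (w', l', r')" "w' \<in> Z" "l' < p1" "p1 < r'" using zz(2) unfolding Z2_def by blast
      obtain w'' where w: "w'' \<in> Z" "\<forall>t s0 u0. F w'' t s0 u0 \<longrightarrow> F w t s0 u0 \<and> F w' t s0 u0" using F_filt[OF z(2) z'(2)] by blast
      show ?thesis
      proof
        show "(w'', max l l', min r r') \<in> Z2" using w(1) z z' by (simp add: Z2_def)
        show "F2 (w'', max l l', min r r') \<subseteq> F2 z \<inter> F2 z'"
          using w(2) unfolding z(1) z'(1) F2_def prod.case max_less_iff_conj min_less_iff_conj by blast
      qed
    qed
    show "s \<le> t \<and> t \<le> u" if "t \<in> F2 z" for z t using that unfolding F2_def F_def by (auto split: prod.splits)
  qed
  then obtain p2 where p2': "\<forall>z\<in>Z2. \<forall>l r. l < p2 \<and> p2 < r \<longrightarrow> (\<exists>t\<in>F2 z. l < t \<and> t < r)" by blast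
  have p2: "\<exists>t s0 u0. F z t s0 u0 \<and> (l < t \<and> t < r) \<and> (l' < s0 \<and> s0 < r')"
    if "z \<in> Z" "l < p1" "p1 < r" "l' < p2" "p2 < r'" for z l r l' r'
    using bspec[OF p2', of "(z, l, r)"] that unfolding Z2_def F2_def by blast
  define Z3 where "Z3 = {(z, l, r, l', r'). z \<in> Z \<and> l < p1 \<and> p1 < r \<and> l' < p2 \<and> p2 < r'}"
  define F3 where "F3 = (\<lambda>(z, l, r, l', r'). {u0. \<exists>t s0. F z t s0 u0 \<and> (l < t \<and> t < r) \<and> (l' < s0 \<and> s0 < r')})"
  have "\<exists>p. \<forall>z\<in>Z3. \<forall>l r. l < p \<and> p < r \<longrightarrow> (\<exists>t\<in>F3 z. l < t \<and> t < r)"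
  proof (rule filtered_accumulation[where a = s and b = u])
    have "{x. \<exists>z\<in>Z3. \<forall>t\<in>F3 z. x \<le> t} = {x. \<exists>z\<in>Z. \<exists>l r l' r'. l < p1 \<and> p1 < r \<and> l' < p2 \<and> p2 < r' \<and>
        (\<forall>u0. (\<exists>t s0. F z t s0 u0 \<and> (l < t \<and> t < r) \<and> (l' < s0 \<and> s0 < r')) \<longrightarrow> x \<le> u0)}"
      unfolding Z3_def F3_def by auto
    moreover have "dset \<dots>"
      unfolding dset_def mem_Collect_eq by (rule dfn_bexl[OF definable_Z]) (intro dfn_rules F_dfn)
    ultimately show "dset {x. \<exists>z\<in>Z3. \<forall>t\<in>F3 z. x \<le> t}" by simp
    show "Z3 \<noteq> {}" using Z_nonempty ex_less[of p1] ex_greater[of p1] ex_less[of p2] ex_greater[of p2]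
      unfolding Z3_def by blast
    show "F3 z \<noteq> {}" if "z \<in> Z3" for z
      using that p2 unfolding Z3_def F3_def by fastforce
    show "\<exists>z''\<in>Z3. F3 z'' \<subseteq> F3 z \<inter> F3 z'" if zz: "z \<in> Z3" "z' \<in> Z3" for z z'
    proof -
      obtain w l r a b where z: "z = (w, l, r, a, b)" "w \<in> Z" "l < p1" "p1 < r" "a < p2" "p2 < b"
        using zz(1) unfolding Z3_def by blast
      obtain w' l' r' a' b' where z': "z' = (w', l', r', a', b')" "w' \<in> Z" "l' < p1" "p1 < r'" "a' < p2" "p2 < b'"
        using zz(2) unfolding Z3_def by blast
      obtain w'' where w: "w'' \<in> Z" "\<forall>t s0 u0. F w'' t s0 u0 \<longrightarrow> F w t s0 u0 \<and> F w' t s0 u0" using F_filt[OF z(2) z'(2)] by blast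
      show ?thesis
      proof
        show "(w'', max l l', min r r', max a a', min b b') \<in> Z3" using w(1) z z' by (simp add: Z3_def)
        show "F3 (w'', max l l', min r r', max a a', min b b') \<subseteq> F3 z \<inter> F3 z'"
          using w(2) unfolding z(1) z'(1) F3_def prod.case max_less_iff_conj min_less_iff_conj by blast
      qed
    qed
    show "s \<le> t \<and> t \<le> u" if "t \<in> F3 z" for z t using that unfolding F3_def F_def by (auto split: prod.splits)
  qed
  then obtain p3 where p3': "\<forall>z\<in>Z3. \<forall>l r. l < p3 \<and> p3 < r \<longrightarrow> (\<exists>t\<in>F3 z. l < t \<and> t < r)" by blast
  have p3: "\<exists>t s0 u0. F z t s0 u0 \<and> (l < t \<and> t < r) \<and> (l' < s0 \<and> s0 < r') \<and> (l'' < u0 \<and> u0 < r'')"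
    if "z \<in> Z" "l < p1" "p1 < r" "l' < p2" "p2 < r'" "l'' < p3" "p3 < r''" for z l r l' r' l'' r''
    using bspec[OF p3', of "(z, l, r, l', r')"] that unfolding Z3_def F3_def by blast
  \<comment> \<open>In each coordinate the window is so small that any two of its points differ by
    less than \<open>s\<close>, the margin built into \<open>K1\<close>.\<close>
  obtain l1 r1 where b1: "l1 < p1" "p1 < r1" "\<forall>a b. a \<le> r1 \<longrightarrow> l1 \<le> b \<longrightarrow> a < b + s" using small_nbhd[OF su(1), of p1] by blast
  obtain l2 r2 where b2: "l2 < p2" "p2 < r2" "\<forall>a b. a \<le> r2 \<longrightarrow> l2 \<le> b \<longrightarrow> a < b + s" using small_nbhd[OF su(1), of p2] by blast
  obtain l3 r3 where b3: "l3 < p3" "p3 < r3" "\<forall>a b. a \<le> r3 \<longrightarrow> l3 \<le> b \<longrightarrow> a < b + s" using small_nbhd[OF su(1), of p3] by blast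
  note box = p3[OF _ b1(1,2) b2(1,2) b3(1,2)]
  \<comment> \<open>The family is used twice. An arbitrary index gives a triple
    \<open>(t1,s1,u1)\<close> in the window, whose goodness supplies a bound \<open>z\<close>. The
    member for this \<open>z\<close> then gives a tuple not bounded by \<open>z\<close> at a nearby
    triple, yet by the margins that tuple lies in a fibre which \<open>z\<close> does bound.\<close>
  obtain z0 where "z0 \<in> Z" using Z_nonempty by blast
  then obtain t1 s1 u1 where A: "F z0 t1 s1 u1" "l1 < t1" "t1 < r1" "l2 < s1" "s1 < r2" "l3 < u1" "u1 < r3"
    using box by blast
  then obtain z where z: "z \<in> Z" "\<forall>t'. t' < t1 + s \<and> t1 < t' + s \<longrightarrow> kap c t' s1 u1 z"
    unfolding F_def good_def by blast
  obtain t2 s2 u2 where B: "F z t2 s2 u2" "l1 < t2" "t2 < r1" "l2 < s2" "s2 < r2" "l3 < u2" "u2 < r3"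
    using box[OF z(1)] by blast
  then obtain y s' u' where y: "length y = k" "take m y = c" "y ! m = t2" "s2 + s \<le> s'" "0 < u'" "u' + s \<le> u2"
    "K y s' u'" "\<not> D y z" unfolding F_def by blast
  have "t2 < t1 + s" "t1 < t2 + s" using b1(3) A(2,3) B(2,3) by (simp_all add: less_imp_le)
  then have kap: "kap c t2 s1 u1 z" using z(2) by blast
  have "s1 < s2 + s" using b2(3) A(5) B(4) by (simp add: less_imp_le)
  then have s': "s1 \<le> s'" using y(4) by (meson less_imp_le less_le_trans)
  have "u2 < u1 + s" using b3(3) A(6) B(7) by (simp add: less_imp_le)
  then have "u' + s < u1 + s" using y(6) by (rule le_less_trans[rotated])
  then have u': "u' \<le> u1" by (simp add: add_less_right_iff less_imp_le)
  have "s \<le> s1" using A(1) unfolding F_def by blast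
  then have "0 < s1" using su(1) by (rule less_le_trans[rotated])
  then have "K y s1 u1" using K_mono[OF y(7) _ s' u'] by blast
  then have "D y z" using kap y(1,2,3) unfolding kap_def by blast
  then show False using y(8) by blast
qed

lemma exhaust_pred: "exhaust m (\<lambda>y s u. K1 y s u \<or> K2 y s u)"
  unfolding exhaust_def
proof (intro conjI)
  show "dfn (\<lambda>e. K1 (map (\<lambda>i. e (Suc (Suc i))) [0..<k]) (e 0) (e (Suc 0)) \<or>
                 K2 (map (\<lambda>i. e (Suc (Suc i))) [0..<k]) (e 0) (e (Suc 0)))"
    unfolding K1_def K2_def
    by (rule dfn_disj)
      (use m in \<open>intro dfn_rules good_dfn isbad_dfn tml_take[where k = k] tm_nth[where k = k] K_dfn tml_vars; simp\<close>)+
  show "\<forall>y s u s' u'. K1 y s u \<or> K2 y s u \<longrightarrow> 0 < s' \<longrightarrow> s' \<le> s \<longrightarrow> u \<le> u' \<longrightarrow> K1 y s' u' \<or> K2 y s' u'"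
  proof (intro allI impI)
    fix y s u s' u' assume h: "K1 y s u \<or> K2 y s u" "0 < s'" "s' \<le> s" "u \<le> u'"
    have un: "- u' \<le> - u" using h(4) by (simp add: neg_le_iff)
    show "K1 y s' u' \<or> K2 y s' u'"
    proof (cases "K2 y s u")
      case True
      then have "K2 y s' u'" unfolding K2_def using K_mono[OF _ h(2-4)] un h(4) by (meson order_trans)
      then show ?thesis ..
    next
      case False
      then have "K1 y s u" using h(1) by blast
      then obtain s0 u0 s1 u1 where a: "- u \<le> y ! m" "y ! m \<le> u" "s \<le> s0" "s0 \<le> u" "s \<le> u0" "u0 \<le> u"
        "good (take m y) (y ! m) s0 u0 s" "s0 + s \<le> s1" "0 < u1" "u1 + s \<le> u0" "K y s1 u1"
        unfolding K1_def by blast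
      have "s0 + s' \<le> s0 + s" "u1 + s' \<le> u1 + s" using h(3) by (simp_all add: add_le_left_iff)
      then have "s0 + s' \<le> s1" "u1 + s' \<le> u0" using a(8,10) order_trans by blast+
      moreover have "good (take m y) (y ! m) s0 u0 s'" using good_mono[OF a(7) h(3)] .
      moreover have "- u' \<le> y ! m" "y ! m \<le> u'" "s' \<le> s0" "s0 \<le> u'" "s' \<le> u0" "u0 \<le> u'"
        using a(1-6) h(3,4) un order_trans by blast+
      ultimately have "K1 y s' u'" unfolding K1_def using a(9,11) by blast
      then show ?thesis ..
    qed
  qed
  show "\<forall>y\<in>Y. \<exists>s u. 0 < s \<and> 0 < u \<and> (K1 y s u \<or> K2 y s u)"
  proof
    fix y assume "y \<in> Y"
    then obtain s1 u1 where su: "0 < s1" "0 < u1" "K y s1 u1" using exhaustD(3)[OF K] by blast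
    define t where "t = y ! m"
    have t: "- max t (- t) \<le> t" "t \<le> max t (- t)"
      using neg_le_iff[of "max t (- t)" "- t"] by simp_all
    show "\<exists>s u. 0 < s \<and> 0 < u \<and> (K1 y s u \<or> K2 y s u)"
    proof (cases "isbad (take m y) t")
      case True
      define u where "u = max u1 (max t (- t))"
      have u: "u1 \<le> u" "max t (- t) \<le> u" by (simp_all add: u_def)
      have "0 < u" using su(2) u(1) by (rule less_le_trans)
      moreover have "K y s1 u" using K_mono[OF su(3) su(1) order_refl u(1)] .
      moreover have "- u \<le> - max t (- t)" using u(2) by (simp only: neg_le_iff)
      then have "- u \<le> t" "t \<le> u" using t u(2) order_trans by blast+
      ultimately show ?thesis using True su(1) unfolding K2_def t_def by blast
    next
      case False
      \<comment> \<open>Strict inequalities between the stage \<open>(s1,u1)\<close> of the tuple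
        and the pair \<open>(s0,u0)\<close> leave room for a positive margin \<open>h\<close>.
        Goodness is then invoked at \<open>(s0,u0)\<close>, and \<open>s\<close> is taken below the
        margin and the radius obtained.\<close>
      obtain s0 where s0: "0 < s0" "s0 < s1" using dense_between[OF su(1)] by blast
      obtain u0 where u0: "u1 < u0" using ex_greater by blast
      have u0p: "0 < u0" using su(2) u0 by (rule less_trans)
      obtain r where r: "0 < r" "good (take m y) t s0 u0 r"
        using False s0(1) u0p unfolding isbad_def by blast
      obtain d1 where d1: "0 < d1" "s0 + d1 \<le> s1" using pos_gap[OF s0(2)] .
      obtain d2 where d2: "0 < d2" "u1 + d2 \<le> u0" using pos_gap[OF u0] .
      obtain h where h: "0 < h" "s0 + h \<le> s1" "u1 + h \<le> u0" using pos_min[OF d1(1) d2(1) d1(2) d2(2)] by blast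
      define s where "s = min h (min r (min s0 u0))"
      define u where "u = max s0 (max u0 (max t (- t)))"
      have s: "0 < s" "s \<le> h" "s \<le> r" "s \<le> s0" "s \<le> u0" using h(1) r(1) s0(1) u0p by (simp_all add: s_def min_le_iff_disj)
      have u: "s0 \<le> u" "u0 \<le> u" "max t (- t) \<le> u" by (simp_all add: u_def le_max_iff_disj)
      have "0 < u" using u0p u(2) by (rule less_le_trans)
      have "- u \<le> - max t (- t)" using u(3) by (simp only: neg_le_iff)
      then have "- u \<le> t" "t \<le> u" using t u(3) order_trans by blast+
      moreover have "s0 + s \<le> s0 + h" "u1 + s \<le> u1 + h" using s(2) by (simp_all add: add_le_left_iff)
      then have "s0 + s \<le> s1" "u1 + s \<le> u0" using h(2,3) order_trans by blast+
      moreover have "good (take m y) t s0 u0 s" using good_mono[OF r(2) s(3)] .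
      ultimately have "K1 y s u" unfolding K1_def t_def[symmetric] using s(4,5) u(1,2) su(2,3) by blast
      then show ?thesis using s(1) \<open>0 < u\<close> by blast
    qed
  qed
  show "\<forall>c s u. 0 < s \<longrightarrow> 0 < u \<longrightarrow> (\<exists>z\<in>Z. \<forall>y. length y = k \<longrightarrow> take m y = c \<longrightarrow> K1 y s u \<or> K2 y s u \<longrightarrow> D y z)"
  proof (intro allI impI)
    fix c :: "'m list" and s u :: 'm assume su: "0 < s" "0 < u"
    show "\<exists>z\<in>Z. \<forall>y. length y = k \<longrightarrow> take m y = c \<longrightarrow> K1 y s u \<or> K2 y s u \<longrightarrow> D y z"
    proof (cases "length c = m")
      case True
      obtain z1 where z1: "z1 \<in> Z" "\<forall>y. length y = k \<longrightarrow> take m y = c \<longrightarrow> K1 y s u \<longrightarrow> D y z1"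
        using K1_bounded[OF True su] by blast
      obtain z2 where z2: "z2 \<in> Z" "\<forall>y. length y = k \<longrightarrow> take m y = c \<longrightarrow> K2 y s u \<longrightarrow> D y z2"
        using K2_bounded[OF True su] by blast
      obtain z where "z \<in> Z" "\<forall>y. D y z1 \<or> D y z2 \<longrightarrow> D y z" using directed[OF z1(1) z2(1)] by blast
      then show ?thesis using z1(2) z2(2) by blast
    next
      case False
      then have "take m y \<noteq> c" if "length y = k" for y using m that by auto
      then show ?thesis using Z_nonempty by blast
    qed
  qed
qed

end

context directed_cover
begin

text \<open>Starting from all coordinates fixed, each step releases the last fixed one. As
  \<open>k - j\<close> is truncated, steps beyond \<open>k\<close> change nothing.\<close>

theorem exhaustion:
  "\<exists>K. dfn (\<lambda>e. K (map (\<lambda>i. e (Suc (Suc i))) [0..<k]) (e 0) (e (Suc 0))) \<and>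
     (\<forall>y s u s' u'. K y s u \<longrightarrow> 0 < s' \<longrightarrow> s' \<le> s \<longrightarrow> u \<le> u' \<longrightarrow> K y s' u') \<and>
     (\<forall>y\<in>Y. \<exists>s u. 0 < s \<and> 0 < u \<and> K y s u) \<and>
     (\<forall>s u. 0 < s \<longrightarrow> 0 < u \<longrightarrow> (\<exists>z\<in>Z. \<forall>y. length y = k \<longrightarrow> K y s u \<longrightarrow> D y z))"
proof -
  have "\<exists>K. exhaust (k - j) K" for j
  proof (induction j)
    case 0
    then show ?case using exhaust_top by auto
  next
    case (Suc j)
    show ?case
    proof (cases "j < k")
      case False
      then show ?thesis using Suc by simp
    next
      case True
      then have "Suc (k - Suc j) = k - j" "k - Suc j < k" by auto
      then obtain K where "exhaust (Suc (k - Suc j)) K" using Suc by auto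
      then interpret exhaust_step I k l Y Z D "k - Suc j" K
        by unfold_locales (use \<open>k - Suc j < k\<close> in auto)
      show ?thesis using exhaust_pred by blast
    qed
  qed
  from this[of k] obtain K where "exhaust 0 K" by auto
  note K = exhaustD[OF this]
  have bound: "\<exists>z\<in>Z. \<forall>y. length y = k \<longrightarrow> K y s u \<longrightarrow> D y z" if "0 < s" "0 < u" for s u
    using K(4)[OF that, of "[]"] by simp
  show ?thesis
    by (intro exI[of _ K] conjI allI ballI impI)
      (rule K(1) | (rule K(2); assumption) | (rule K(3); assumption) | (rule bound; assumption))+
qed

end

section \<open>Constructing the curve\<close>

context dclo_group
begin

lemma definable_curveI:
  assumes g: "tml n (\<lambda>e. g (e 0))"
  shows "definable_curve I n {0<..} g"
proof -
  have len: "length (g a) = n" for a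
    using g[unfolded tml_def, THEN conjunct1, rule_format, of "\<lambda>_. a"] by simp
  have "dfn (\<lambda>e. 0 < hd (map e [0..<Suc n]) \<and> tl (map e [0..<Suc n]) = g (hd (map e [0..<Suc n])))"
  proof -
    have "map e [0..<Suc n] = e 0 # map (\<lambda>i. e (Suc i)) [0..<n]" for e :: "nat \<Rightarrow> 'm"
      by (simp add: map_upt_Suc del: upt_Suc)
    then have "?thesis \<longleftrightarrow> dfn (\<lambda>e. 0 < e 0 \<and> map (\<lambda>i. e (Suc i)) [0..<n] = g (e 0))" by simp
    moreover have "dfn (\<lambda>e. 0 < e 0 \<and> map (\<lambda>i. e (Suc i)) [0..<n] = g (e 0))"
      by (intro dfn_conj dfn_less dfn_eql[where n = n] tm_var tm_const tml_vars g)
    ultimately show ?thesis by simp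
  qed
  then have "definable I (Suc n) {xs. length xs = Suc n \<and> 0 < hd xs \<and> tl xs = g (hd xs)}"
    by (rule definableI)
  moreover have "{xs. length xs = Suc n \<and> 0 < hd xs \<and> tl xs = g (hd xs)} = {t # g t | t. t \<in> {0<..}}"
  proof (rule set_eqI)
    fix xs
    show "xs \<in> {xs. length xs = Suc n \<and> 0 < hd xs \<and> tl xs = g (hd xs)} \<longleftrightarrow> xs \<in> {t # g t | t. t \<in> {0<..}}"
      by (cases xs) (auto simp: len)
  qed
  ultimately show ?thesis unfolding definable_curve_def by (simp add: len)
qed

theorem curve_selection:
  assumes space: "definable_top_space I n \<tau>" and reg: "regular_space \<tau>"
    and lcpt: "locally_definably_compact I n \<tau>"
    and C: "definable I n C" "closedin \<tau> C" and x: "x \<in> C"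
    and acc: "\<forall>U. openin \<tau> U \<and> x \<in> U \<longrightarrow> (\<exists>z\<in>U \<inter> C. z \<noteq> x)"
  shows "\<exists>\<gamma>. definable_curve I n {0<..} \<gamma> \<and> (\<forall>t>0. \<gamma> t \<in> C - {x}) \<and>
           x \<in> conv_left I n \<tau> {0<..} \<gamma> \<union> conv_right I n \<tau> {0<..} \<gamma>"
proof -
  have length_n: "length w = n" if "definable I n A" "w \<in> A" for A w
    using that unfolding definable_def by blast
  have xn: "length x = n" using length_n[OF C(1) x] .
  have xX: "x \<in> topspace \<tau>" using closedin_subset[OF C(2)] x by blast
  have lX: "length w = n" if "w \<in> topspace \<tau>" for w
    using length_n[OF _ that] space unfolding definable_top_space_def by blast
  obtain k B Y where B: "definable I (n + k) B" and Y: "definable I k Y"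
    and Bopen: "\<forall>y\<in>Y. openin \<tau> (fibre n B y)"
    and base: "\<forall>U. openin \<tau> U \<longrightarrow> (\<forall>z\<in>U. \<exists>y\<in>Y. z \<in> fibre n B y \<and> fibre n B y \<subseteq> U)"
    using space unfolding definable_top_space_def by (elim conjE exE) (rule that)
  have inB: "w @ y \<in> B \<longleftrightarrow> w \<in> fibre n B y" if "length w = n" for w y
    using that by (simp add: fibre_def)
  have B_dfn: "dfn (\<lambda>e. v e @ w e \<in> B)" if "tml n v" "tml k w" for v w
    by (intro dfn_mem[OF B] tml_append that)
  define Z where "Z = {y. length y = k \<and> (y \<in> Y \<and> x @ y \<in> B)}"
  have Z: "definable I k Z"
    unfolding Z_def by (rule definableI) (intro dfn_conj dfn_mem[OF Y] B_dfn tml_vars tml_const xn)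
  have Z_iff: "y \<in> Z \<longleftrightarrow> y \<in> Y \<and> x \<in> fibre n B y" for y
    using length_n xn Y unfolding Z_def definable_def by (auto simp: fibre_def)
  define D where "D y z \<longleftrightarrow> (\<forall>w. length w = n \<longrightarrow> (w @ z \<in> B \<longrightarrow> w @ y \<in> B))" for y z
  have D_iff: "D y z \<longleftrightarrow> fibre n B z \<subseteq> fibre n B y" for y z
    unfolding D_def by (auto simp: fibre_def)
  have D_dfn: "dfn (\<lambda>e. D (map e [0..<k]) (map (\<lambda>i. e (i + k)) [0..<k]))"
    unfolding D_def by (rule dfn_alll) (intro dfn_imp B_dfn tml_vars)
  have nbhd: "\<exists>z\<in>Z. fibre n B z \<subseteq> U" if "openin \<tau> U" "x \<in> U" for U
    using base that Z_iff by blast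
  interpret directed_cover I k k Z Z D
  proof (intro directed_cover.intro directed_cover_axioms.intro dclo_group_axioms Z D_dfn)
    show "Z \<noteq> {}" using nbhd[OF openin_topspace xX] by blast
    show "\<exists>z''\<in>Z. \<forall>y. D y z \<or> D y z' \<longrightarrow> D y z''" if "z \<in> Z" "z' \<in> Z" for z z'
    proof -
      have "openin \<tau> (fibre n B z \<inter> fibre n B z')" "x \<in> fibre n B z \<inter> fibre n B z'"
        using that Bopen by (auto simp: Z_iff)
      then obtain z'' where "z'' \<in> Z" "fibre n B z'' \<subseteq> fibre n B z \<inter> fibre n B z'" using nbhd by blast
      then show ?thesis unfolding D_iff by blast
    qed
    show "\<exists>z\<in>Z. D y z" if "y \<in> Z" for y using that unfolding D_iff by blast
  qed
  obtain K where K_base: "dfn (\<lambda>e. K (map (\<lambda>i. e (Suc (Suc i))) [0..<k]) (e 0) (e (Suc 0)))"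
    and K_mono: "\<forall>y s u s' u'. K y s u \<longrightarrow> 0 < s' \<longrightarrow> s' \<le> s \<longrightarrow> u \<le> u' \<longrightarrow> K y s' u'"
    and K_exh: "\<forall>y\<in>Z. \<exists>s u. 0 < s \<and> 0 < u \<and> K y s u"
    and K_bdd: "\<forall>s u. 0 < s \<longrightarrow> 0 < u \<longrightarrow> (\<exists>z\<in>Z. \<forall>y. length y = k \<longrightarrow> K y s u \<longrightarrow> D y z)"
    using exhaustion by (elim exE conjE) (rule that)
  obtain N where N: "definable I n N" "N \<subseteq> topspace \<tau>" "is_nbhd \<tau> N x" "definably_compact I n \<tau> N"
    using lcpt xX unfolding locally_definably_compact_def by blast
  \<comment> \<open>Only the point \<open>w\<close> is to be chosen, so the bound \<open>z\<close>
    remains quantified. A candidate exists because \<open>fibre n B z\<close> and \<open>N\<close>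
    are both neighbourhoods of \<open>x\<close>, which is not isolated in \<open>C\<close>.\<close>
  define R where "R s u w \<longleftrightarrow> (w \<in> C \<and> w \<in> N \<and> w \<noteq> x) \<and>
      (\<exists>z\<in>Z. (\<forall>y. length y = k \<longrightarrow> (K y s u \<longrightarrow> D y z)) \<and> w @ z \<in> B)" for s u w
  define f where "f s u = pickl n {w. R s u w}" for s u
  have R_dfn: "dfn (\<lambda>e. R (e (i + n)) (e (j + n)) (map e [0..<n]))" for i j
    unfolding R_def
    by (rule dfn_conj, intro dfn_conj dfn_mem[OF C(1)] dfn_mem[OF N(1)] dfn_neg dfn_eql[where n = n] tml_vars tml_const xn,
        rule dfn_bexl[OF Z], intro dfn_conj dfn_alll dfn_imp dfn_inst_l11[OF K_base] dfn_inst_ll[OF D_dfn]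
          B_dfn tml_vars tm_var)
  have f_tml: "tml n (\<lambda>e. f (e 0) (e (Suc 0)))"
    unfolding f_def by (rule tml_pickl[where P = "\<lambda>w e. R (e 0) (e (Suc 0)) w", OF R_dfn])
  have fR: "R s u (f s u)" if su: "0 < s" "0 < u" for s u
  proof -
    obtain z where z: "z \<in> Z" "\<forall>y. length y = k \<longrightarrow> K y s u \<longrightarrow> D y z" using K_bdd su by blast
    obtain U where U: "openin \<tau> U" "x \<in> U" "U \<subseteq> N" using N(3) unfolding is_nbhd_def by blast
    have "openin \<tau> (fibre n B z \<inter> U)" "x \<in> fibre n B z \<inter> U" using U z(1) Bopen by (auto simp: Z_iff)
    then obtain w where w: "w \<in> fibre n B z \<inter> U" "w \<in> C" "w \<noteq> x" using acc by blast
    then have "R s u w" unfolding R_def using z U(3) by (auto simp: fibre_def)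
    then show ?thesis
      unfolding f_def
      using pickl_in[where P = "\<lambda>w e. R (e 0) (e (Suc 0)) w" and e = "case_nat s (\<lambda>_. u)", OF R_dfn, of w]
        length_n[OF C(1) w(2)] by simp
  qed
  have fC: "f s u \<in> C" "f s u \<in> N" "f s u \<noteq> x" "length (f s u) = n" if "0 < s" "0 < u" for s u
    using fR[OF that] length_n[OF C(1)] unfolding R_def by blast+
  \<comment> \<open>The exhaustion pays off here: once \<open>y\<close> has entered the stage
    \<open>(s,u)\<close>, the basic neighbourhood bounding that stage lies inside the one with index
    \<open>y\<close>, and it contains \<open>f s u\<close>.\<close>
  have fK: "f s u \<in> fibre n B y" if su: "0 < s" "0 < u" and y: "y \<in> Z" "K y s u" for s u y
  proof -
    obtain z where "\<forall>y. length y = k \<longrightarrow> (K y s u \<longrightarrow> D y z)" "f s u @ z \<in> B"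
      using fR[OF su] unfolding R_def by blast
    moreover have "length y = k" using y(1) by (simp add: Z_def)
    ultimately show ?thesis using y(2) fC(4)[OF su] unfolding D_iff by (auto simp: inB)
  qed
  \<comment> \<open>Membership of \<open>p\<close> in \<open>N\<close> and in the closure of the
    tail from \<open>w\<close> on, phrased through the basic open sets so that it is visibly
    definable; \<open>T_closure\<close> is the translation.\<close>
  define T where "T s p w \<longleftrightarrow> p \<in> N \<and> (\<forall>y\<in>Y. p @ y \<in> B \<longrightarrow> (\<exists>u. w \<le> u \<and> f s u @ y \<in> B))" for s p w
  have T_dfn: "dfn (\<lambda>e. T (s e) (p e) (w e))" if "tm s" "tml n p" "tm w" for s p w
    unfolding T_def
    by (rule dfn_conj, rule dfn_mem[OF N(1) that(2)], rule dfn_balll[OF Y])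
      (intro dfn_imp dfn_ex dfn_conj dfn_le B_dfn tml_vars tm_var tml_inst_11[OF f_tml]
        tml_rename[OF that(2)] tm_rename[OF that(1)] tm_rename[OF that(3)])
  have T_closure: "T s p w \<longleftrightarrow> p \<in> N \<and> p \<in> \<tau> closure_of {f s u | u. w \<le> u}" if sw: "0 < s" "0 < w" for s p w
  proof (cases "p \<in> N")
    case True
    then have pX: "p \<in> topspace \<tau>" using N(2) by blast
    have fn: "length (f s u) = n" if "w \<le> u" for u using fC(4)[OF sw(1) less_le_trans[OF sw(2) that]] .
    have "T s p w \<longleftrightarrow> (\<forall>y\<in>Y. p \<in> fibre n B y \<longrightarrow> (\<exists>u. w \<le> u \<and> f s u \<in> fibre n B y))"
      unfolding T_def using True lX[OF pX] fn by (auto simp: inB) (metis inB)+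
    also have "\<dots> \<longleftrightarrow> (\<forall>U. p \<in> U \<and> openin \<tau> U \<longrightarrow> (\<exists>u. w \<le> u \<and> f s u \<in> U))"
      using base Bopen by (meson subsetD)
    also have "\<dots> \<longleftrightarrow> p \<in> \<tau> closure_of {f s u | u. w \<le> u}"
      using pX unfolding in_closure_of by auto
    finally show ?thesis using True by simp
  qed (simp add: T_def)
  have T_C: "p \<in> C" if "T s p w" "0 < s" "0 < w" for s p w
  proof -
    have "{f s u | u. w \<le> u} \<subseteq> C" using fC(1)[OF that(2)] less_le_trans[OF that(3)] by blast
    then have "\<tau> closure_of {f s u | u. w \<le> u} \<subseteq> C" using C(2) by (rule closure_of_minimal)
    then show ?thesis using that T_closure by blast
  qed
  have T_ex: "\<exists>p. \<forall>w. 0 < w \<longrightarrow> T s p w" if s: "0 < s" for s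
  proof -
    \<comment> \<open>Definable compactness of \<open>N\<close> is applied to the closures of the
      tails in \<open>N\<close>, which decrease as \<open>w\<close> grows. The index
      \<open>w > 0\<close> is coded as a list of length 1.\<close>
    define F where "F = {xs. length xs = n + 1 \<and> T s (take n xs) (xs ! n)}"
    define W where "W = {ys :: 'm list. length ys = 1 \<and> 0 < ys ! 0}"
    have F: "definable I (n + 1) F"
      unfolding F_def
      by (rule definableI, intro T_dfn tm_const tml_take[where k = "n + 1"] tm_nth[where k = "n + 1"] tml_vars) simp_all
    have W: "definable I 1 W"
      unfolding W_def by (rule definableI, intro dfn_less tm_const tm_nth[where k = 1] tml_vars) simp
    have T_len: "length p = n" if "T s p w" for p w
      using length_n[OF N(1), of p] that unfolding T_def by blast
    have "p \<in> fibre n F [w] \<longleftrightarrow> length p = n \<and> T s p w" for p w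
      unfolding fibre_def F_def by (simp add: nth_append cong: conj_cong)
    then have fib: "fibre n F [w] = {p. T s p w}" for w using T_len by blast
    have W_iff: "y \<in> W \<longleftrightarrow> (\<exists>w. 0 < w \<and> y = [w])" for y
      unfolding W_def by (auto simp: length_Suc_conv)
    have T_mono: "T s p w" if "T s p w'" "w \<le> w'" for p w w'
      using that unfolding T_def by (meson order_trans)
    have "fibre n F y \<noteq> {} \<and> closedin (subtopology \<tau> N) (fibre n F y)" if "y \<in> W" for y
    proof -
      obtain w where w: "0 < w" "y = [w]" using \<open>y \<in> W\<close> W_iff by blast
      have "fibre n F y = \<tau> closure_of {f s u | u. w \<le> u} \<inter> N"
        unfolding w(2) fib using T_closure[OF s w(1)] by blast
      moreover have "f s w \<in> topspace \<tau>" using fC(2)[OF s w(1)] N(2) by blast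
      then have "f s w \<in> \<tau> closure_of {f s u | u. w \<le> u}" unfolding in_closure_of by blast
      ultimately show ?thesis using fC(2)[OF s w(1)] closedin_closure_of unfolding closedin_subtopology by blast
    qed
    moreover have "\<exists>y3\<in>W. fibre n F y3 \<subseteq> fibre n F y1 \<inter> fibre n F y2" if yy: "y1 \<in> W" "y2 \<in> W" for y1 y2
    proof -
      obtain w1 w2 where w: "0 < w1" "y1 = [w1]" "0 < w2" "y2 = [w2]" using yy W_iff by blast
      have "fibre n F [max w1 w2] \<subseteq> fibre n F y1 \<inter> fibre n F y2"
        unfolding w fib using T_mono[of _ "max w1 w2"] by auto
      moreover have "[max w1 w2] \<in> W" using w W_iff by (auto simp: less_max_iff_disj)
      ultimately show ?thesis by blast
    qed
    ultimately have "(\<Inter>y\<in>W. fibre n F y) \<noteq> {}"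
      using N(4)[unfolded definably_compact_def, rule_format, of 1 F W] F W by blast
    then obtain p where "p \<in> (\<Inter>y\<in>W. fibre n F y)" by blast
    then have "T s p w" if "0 < w" for w using that W_iff fib by blast
    then show ?thesis by blast
  qed
  show ?thesis
  proof (cases "\<exists>s>0. \<forall>w. 0 < w \<longrightarrow> T s x w")
    case True
    then obtain s where s: "0 < s" "\<And>w. 0 < w \<Longrightarrow> T s x w" by blast
    have "x \<in> conv_right I n \<tau> {0<..} (f s)"
      unfolding conv_right_def
    proof (intro CollectI conjI ballI allI impI xX)
      fix t :: 'm and A :: "'m list set" assume t: "t \<in> {0<..}" and A: "definable I n A \<and> is_nbhd \<tau> A x"
      obtain U where U: "openin \<tau> U" "x \<in> U" "U \<subseteq> A" using A unfolding is_nbhd_def by blast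
      obtain w where w: "t < w" using ex_greater by blast
      have t0: "0 < t" using t by simp
      have w0: "0 < w" using t0 w by (rule less_trans)
      obtain u where u: "w \<le> u" "f s u \<in> U"
        using s(2)[OF w0] U(1,2) unfolding T_closure[OF s(1) w0] in_closure_of by blast
      have "t < u" using w u(1) by (rule less_le_trans)
      then have "u \<in> {s \<in> {0<..}. t < s}" using less_trans[OF t0] by simp
      then show "f s ` {s \<in> {0<..}. t < s} \<inter> A \<noteq> {}" using u(2) U(3) by blast
    qed
    moreover have "definable_curve I n {0<..} (f s)"
      by (rule definable_curveI) (intro tml_inst_11[OF f_tml] tm_const tm_var)
    ultimately show ?thesis using fC(1,3)[OF s(1)] by (intro exI[of _ "f s"]) simp
  next
    case False
    define g where "g s = pickl n {p. \<forall>w. 0 < w \<longrightarrow> T s p w}" for s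
    have g_base: "dfn (\<lambda>e. \<forall>w. 0 < w \<longrightarrow> T (e (0 + n)) (map e [0..<n]) w)"
      by (intro dfn_all dfn_imp dfn_less tm_const tm_var T_dfn tml_vars)
    have gT: "T s (g s) w" if sw: "0 < s" "0 < w" for s w
    proof -
      obtain p where p: "\<forall>w. 0 < w \<longrightarrow> T s p w" using T_ex[OF sw(1)] by blast
      then have "length p = n" using sw(2) length_n[OF N(1)] unfolding T_def by blast
      then have "\<forall>w. 0 < w \<longrightarrow> T s (g s) w"
        unfolding g_def
        using pickl_in[where P = "\<lambda>p e. \<forall>w. 0 < w \<longrightarrow> T (e 0) p w" and e = "\<lambda>_. s", OF g_base _ p] by simp
      then show ?thesis using sw(2) by blast
    qed
    have "x \<in> conv_left I n \<tau> {0<..} g"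
      unfolding conv_left_def
    proof (intro CollectI conjI ballI allI impI xX)
      fix t :: 'm and A :: "'m list set" assume t: "t \<in> {0<..}" and A: "definable I n A \<and> is_nbhd \<tau> A x"
      obtain U0 where U0: "openin \<tau> U0" "x \<in> U0" "U0 \<subseteq> A" using A unfolding is_nbhd_def by blast
      have cl0: "closedin \<tau> (topspace \<tau> - U0) \<and> x \<in> topspace \<tau> - (topspace \<tau> - U0)"
        using U0(1,2) xX by blast
      \<comment> \<open>Being in \<open>U0\<close> does not pass from a tail to its limit points.
        Missing the open set \<open>V\<close> does: a tail inside \<open>U\<close> avoids
        \<open>V\<close>, so its closure avoids \<open>V\<close> and hence lies in
        \<open>U0\<close>.\<close>
      obtain U V where UV: "openin \<tau> U" "openin \<tau> V" "x \<in> U" "topspace \<tau> - U0 \<subseteq> V" "disjnt U V"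
        using reg[unfolded regular_space_def, rule_format, OF cl0] by (elim exE conjE) (rule that)
      obtain y where y: "y \<in> Z" "fibre n B y \<subseteq> U" using nbhd[OF UV(1,3)] by blast
      \<comment> \<open>By monotonicity \<open>y\<close> remains in \<open>K\<close> for all smaller
        \<open>s\<close> and larger \<open>u\<close>. For every \<open>s < s0\<close> the tail from
        the same \<open>u0\<close> on therefore lies in \<open>U\<close>, and \<open>s\<close> can
        also be taken below the prescribed \<open>t\<close>.\<close>
      obtain s0 u0 where su: "0 < s0" "0 < u0" "K y s0 u0" using K_exh y(1) by blast
      have "0 < min s0 t" using su(1) t by simp
      then obtain s where s: "0 < s" "s < min s0 t" using dense_between by blast
      have fU: "f s u \<in> U" if u: "u0 \<le> u" for u
      proof -
        have "K y s u" using K_mono su(3) s u by (meson less_imp_le min_less_iff_conj)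
        then show ?thesis using fK[OF s(1) less_le_trans[OF su(2) u] y(1)] y(2) by blast
      qed
      have cl: "g s \<in> \<tau> closure_of {f s u | u. u0 \<le> u}"
        using gT[OF s(1) su(2)] T_closure[OF s(1) su(2)] by blast
      have "g s \<in> U0"
      proof (rule ccontr)
        assume "g s \<notin> U0"
        then have "g s \<in> V" using cl UV(4) unfolding in_closure_of by blast
        then obtain u where "u0 \<le> u" "f s u \<in> V" using cl UV(2) unfolding in_closure_of by blast
        then show False using fU UV(5) unfolding disjnt_def by blast
      qed
      moreover have "s \<in> {s \<in> {0<..}. s < t}" using s by simp
      ultimately show "g ` {s \<in> {0<..}. s < t} \<inter> A \<noteq> {}" using U0(3) by blast
    qed
    moreover have "definable_curve I n {0<..} g"
      by (rule definable_curveI) (unfold g_def, rule tml_pickl[where P = "\<lambda>p e. \<forall>w. 0 < w \<longrightarrow> T (e 0) p w", OF g_base])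
    moreover have "g s \<in> C - {x}" if "0 < s" for s
    proof -
      \<comment> \<open>Limit points stay in \<open>C\<close> because \<open>C\<close> is closed;
        any positive \<open>w\<close>, here \<open>unit0\<close>, will do.\<close>
      have "g s \<in> C" using T_C[OF gT[OF that unit0_pos] that unit0_pos] .
      moreover have "g s \<noteq> x" using False that gT[OF that] by metis
      ultimately show ?thesis by blast
    qed
    ultimately show ?thesis by (intro exI[of _ g]) simp
  qed
qed

end

theorem theorem4p14:
  fixes I :: "'r \<Rightarrow> 'm::{group_add,linorder} list \<Rightarrow> bool"
    and n :: nat and \<tau> :: "'m list topology" and C :: "'m list set" and x :: "'m list"
  assumes "ordered_group_dense_no_endpoints TYPE('m)"
    and "expands_ordered_group I"
    and "definably_complete I"
    and "locally_o_minimal I"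
    and "definable_top_space I n \<tau>"
    and "regular_space \<tau>"
    and "locally_definably_compact I n \<tau>"
    and "definable I n C" and "closedin \<tau> C"
    and "x \<in> C"
    and "\<forall>U. openin \<tau> U \<and> x \<in> U \<longrightarrow> (\<exists>z\<in>U \<inter> C. z \<noteq> x)"
  shows "\<exists>\<gamma>. definable_curve I n {0<..} \<gamma> \<and> (\<forall>t>0. \<gamma> t \<in> C - {x}) \<and>
           x \<in> conv_left I n \<tau> {0<..} \<gamma> \<union> conv_right I n \<tau> {0<..} \<gamma>"
proof -
  interpret dclo_group I using assms(1-4) by unfold_locales
  show ?thesis using assms(5-11) by (rule curve_selection)
qed

end
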